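(* Let $\mathfrak{F}\subseteq\mathfrak{F}_{\mathrm{all}}$ satisfy $\mathfrak{F}\supseteq\mathfrak{F}_{\mathrm{AR}(2)}^{ext}$. Suppose that the cyclical trend assumption holds: $X=(E_{n,0}(\omega),\tilde X)$ for some $\omega\in(0,\pi)$, where $\tilde X$ is an $n\times(k-2)$-dimensional matrix such that $X$ has rank $k$ ($\tilde X$ is the empty matrix if $k=2$), and the restriction matrix $R$ has a nonzero column $R_{\cdot i}$ for some $i\in\{1,2\}$. Let $T$ be a nonsphericity-corrected F-type test statistic based on $\check\beta$ and $\check\Omega$, where $(\check\beta,\check\Omega,N)$ satisfies the estimator conditions. Furthermore, assume that for every $v\in\mathbb{R}^q$ with $v\ne0$ we have $\lambda_{\mathbb{R}^n}(\{y\in\mathbb{R}^n\setminus N^*:v'\check\Omega^{-1}(y)v=0\})=0$. Then for every critical value $C$, $-\infty<C<\infty$, for every $\mu_0\in\mathfrak{M}_0$, and for every $\sigma^2\in(0,\infty)$ it holds that $$P_{0,I_n}(\check\Omega\text{ is nonnegative definite})\le K(\omega)\le\sup_{f\in\mathfrak{F}}P_{\mu_0,\sigma^2\Sigma(f)}(T\ge C),$$ where $$K(\omega)=\int\Pr\left(\bar\xi_\omega(x)\ge0\right)dP_{0,I_2}(x),$$ and where, for $\mathbf{G}$ a standard normal random $n$-vector, $\bar\xi_\omega(x)=\left(R\hat\beta_X(E_{n,\rho(\omega)}(\omega)x)\right)'\check\Omega^{-1}(\mathbf{G})\,R\hat\beta_X(E_{n,\rho(\omega)}(\omega)x)$ on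 the event $\{\mathbf{G}\in\mathbb{R}^n\setminus N^*\}$ and $\bar\xi_\omega(x)=0$ otherwise.
   Context: Model: $n,k,q$ are positive integers with $1\le k<n$; $X\in\mathbb{R}^{n\times k}$ is a fixed matrix of rank $k$; $R\in\mathbb{R}^{q\times k}$ has rank $q\ge 1$; $r\in\mathbb{R}^q$. (One tests $R\beta=r$ in $\mathbf{Y}=X\beta+\mathbf{U}$, $\mathbf{U}\sim N(0,\sigma^2\Sigma(f))$, $0<\sigma^2<\infty$, $f\in\mathfrak{F}$.) $'$ is transpose, $\mathrm{span}(\cdot)$ is column space, $\mathfrak{M}_0=\{X\beta:R\beta=r\}$, $\mathfrak{M}_0^{lin}=\{X\beta:R\beta=0\}$, $\hat\beta_X(y)=(X'X)^{-1}X'y$. $P_{\mu,A}$ is the Gaussian measure with mean $\mu$ and covariance $A$ (on $\mathbb{R}^n$, or on $\mathbb{R}^2$ for $P_{0,I_2}$); $P(T\ge C)$ means $P(\{y:T(y)\ge C\})$; $P_{0,I_n}(\check\Omega$ is nonnegative definite$)$ is the $P_{0,I_n}$-probability of the set of $y\in\mathbb{R}^n\setminus N$ with $\check\Omega(y)$ nonnegative definite. $\lambda_{\mathbb{R}^n}$ is Lebesgue measure; $\Pr$ is a generic probability. For $\omega\in[0,\pi]$ and integer $s\ge0$, $E_{n,s}(\omega)$ is the $n\times2$ matrix with $j$-th row $(j^s\cos(j\omega),j^s\sin(j\omega))$; $\rho(\omega)=\min\{s\in\mathbb{N}\cup\{0\}:\mathrm{span}(E_{n,s}(\omega))\nsubseteq\mathfrak{M}_0^{lin}\}$.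 Spectral densities: $\mathfrak{F}_{\mathrm{all}}$ is the set of all normalized spectral densities of real weakly stationary processes (nonnegative, even, integrable $f$ on $[-\pi,\pi]$ with $\int_{-\pi}^{\pi}f=1$); $\mathfrak{F}_{\mathrm{AR}(2)}$ is the subset of those corresponding to stationary autoregressive processes of order at most two; $\mathfrak{F}_{\mathrm{AR}(2)}^{ext}$ is the set of all $c_1f+(2\pi)^{-1}c_2$ with $f\in\mathfrak{F}_{\mathrm{AR}(2)}$, $c_1,c_2\ge0$, $c_1+c_2=1$; $\Sigma(f)=\left[\int_{-\pi}^{\pi}e^{-\iota(j-l)\nu}f(\nu)d\nu\right]_{j,l=1}^n$, $\iota$ the imaginary unit. Estimator conditions on $(\check\beta,\check\Omega,N)$: (i) $\check\beta:\mathbb{R}^n\setminus N\to\mathbb{R}^k$ and $\check\Omega:\mathbb{R}^n\setminus N\to\mathbb{R}^{q\times q}$ are well-defined and continuous on $\mathbb{R}^n\setminus N$, where $N$ is a closed $\lambda_{\mathbb{R}^n}$-null set, and $\check\Omega(y)$ is symmetric for every $y\in\mathbb{R}^n\setminus N$; (ii) $y\in\mathbb{R}^n\setminus N$ implies $\delta y+X\eta\in\mathbb{R}^n\setminus N$ for all $\delta\ne0$, $\eta\in\mathbb{R}^k$; (iii) $\check\beta(\delta y+X\eta)=\delta\check\beta(y)+\eta$ and $\check\Omega(\delta y+X\eta)=\delta^2\check\Omega(y)$ for all $y\in\mathbb{R}^n\setminus N$, $\delta\neq0$, $\eta\in\mathbb{R}^k$; (iv) $\check\Omega$ is $\lambda_{\mathbb{R}^n}$-almost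 everywhere nonsingular on $\mathbb{R}^n\setminus N$. Nonsphericity-corrected F-type test statistic: with $N^*=N\cup\{y\in\mathbb{R}^n\setminus N:\det\check\Omega(y)=0\}$, $T(y)=(R\check\beta(y)-r)'\check\Omega^{-1}(y)(R\check\beta(y)-r)$ for $y\in\mathbb{R}^n\setminus N^*$ and $T(y)=0$ for $y\in N^*$. *)

theory Defs
  imports "HOL-Probability.Probability"
begin

section \<open>Linear model\<close>

text \<open>
  The dimensions \<open>n\<close>, \<open>k\<close>, \<open>q\<close> are the cardinalities of the index types \<open>'n\<close>, \<open>'k\<close>, \<open>'q\<close>.  Where the
  number of a row or of a column matters, the index type is linearly ordered, and its elements are
  numbered \<open>1, 2, \<dots>\<close> in increasing order.
\<close>

definition pos :: "'a::{finite,linorder} \<Rightarrow> nat" where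
  "pos i = card {j. j \<le> i}"

definition M0 :: "real^'k^'n \<Rightarrow> real^'k^'q \<Rightarrow> real^'q \<Rightarrow> (real^'n) set" where
  "M0 X R r = {X *v \<beta> |\<beta>. R *v \<beta> = r}"

definition M0lin :: "real^'k^'n \<Rightarrow> real^'k^'q \<Rightarrow> (real^'n) set" where
  "M0lin X R = {X *v \<beta> |\<beta>. R *v \<beta> = 0}"

definition ols :: "real^'k^'n \<Rightarrow> real^'n \<Rightarrow> real^'k" where
  "ols X y = matrix_inv (transpose X ** X) *v (transpose X *v y)"

definition trendE :: "nat \<Rightarrow> real \<Rightarrow> real^2^'n::{finite,linorder}" where
  "trendE s \<omega> = (\<chi> j. vector [real (pos j) ^ s * cos (real (pos j) * \<omega>),
                              real (pos j) ^ s * sin (real (pos j) * \<omega>)])"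

definition rho :: "real^'k^'n::{finite,linorder} \<Rightarrow> real^'k^'q \<Rightarrow> real \<Rightarrow> nat" where
  "rho X R \<omega> = (LEAST s. \<not> span (columns (trendE s \<omega> :: (real^2, 'n) vec)) \<subseteq> M0lin X R)"

text \<open>
  \<open>X = (E\<^bsub>n,0\<^esub>(\<omega>), X')\<close> with an arbitrary \<open>n \<times> (k - 2)\<close> block \<open>X'\<close>: there are at least two
  columns, and the first two are those of \<open>E\<^bsub>n,0\<^esub>(\<omega>)\<close>.
\<close>
definition cyclical_trend :: "real^'k::{finite,linorder}^'n::{finite,linorder} \<Rightarrow> real \<Rightarrow> bool" where
  "cyclical_trend X \<omega> \<longleftrightarrow> 2 \<le> CARD('k) \<and>
     (\<forall>i. (pos i = 1 \<longrightarrow> column i X = column 1 (trendE 0 \<omega>)) \<and>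
          (pos i = 2 \<longrightarrow> column i X = column 2 (trendE 0 \<omega>)))"


section \<open>Spectral densities\<close>

text \<open>
  A density is a function on \<open>[-\<pi>, \<pi>]\<close>, that is, an extensional function (\<open>undefined\<close> outside of the
  interval), so that equality and inclusion of sets of densities only concern values on \<open>[-\<pi>, \<pi>]\<close>.
\<close>

definition F_all :: "(real \<Rightarrow> real) set" where
  "F_all = {f \<in> {-pi..pi} \<rightarrow>\<^sub>E {0..}. (\<forall>\<nu>\<in>{-pi..pi}. f (- \<nu>) = f \<nu>) \<and>
              f absolutely_integrable_on {-pi..pi} \<and> integral {-pi..pi} f = 1}"

definition fourier_coeff :: "(real \<Rightarrow> real) \<Rightarrow> int \<Rightarrow> complex" where
  "fourier_coeff f h = integral {-pi..pi}
     (\<lambda>\<nu>. exp (- (\<i> * of_int h * complex_of_real \<nu>)) * complex_of_real (f \<nu>))"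

text \<open>The coefficients are real because \<open>f\<close> is even, so \<open>Re\<close> only changes the type.\<close>
definition Sigma_mat :: "(real \<Rightarrow> real) \<Rightarrow> real^'n::{finite,linorder}^'n::{finite,linorder}" where
  "Sigma_mat f = (\<chi> j l. Re (fourier_coeff f (int (pos j) - int (pos l))))"

definition cov :: "'a measure \<Rightarrow> ('a \<Rightarrow> real) \<Rightarrow> ('a \<Rightarrow> real) \<Rightarrow> real" where
  "cov M U V = (\<integral>x. (U x - (\<integral>x. U x \<partial>M)) * (V x - (\<integral>x. V x \<partial>M)) \<partial>M)"

definition weakly_stationary :: "'a measure \<Rightarrow> (int \<Rightarrow> 'a \<Rightarrow> real) \<Rightarrow> bool" where
  "weakly_stationary M Z \<longleftrightarrow> prob_space M \<and>
     (\<forall>t. Z t \<in> borel_measurable M \<and> integrable M (\<lambda>x. (Z t x)\<^sup>2)) \<and>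
     (\<forall>s t. (\<integral>x. Z s x \<partial>M) = (\<integral>x. Z t x \<partial>M)) \<and>
     (\<forall>s t h. cov M (Z (s + h)) (Z s) = cov M (Z (t + h)) (Z t))"

definition white_noise :: "'a measure \<Rightarrow> (int \<Rightarrow> 'a \<Rightarrow> real) \<Rightarrow> bool" where
  "white_noise M \<epsilon> \<longleftrightarrow> weakly_stationary M \<epsilon> \<and> (\<forall>t. (\<integral>x. \<epsilon> t x \<partial>M) = 0) \<and>
     (\<forall>t. cov M (\<epsilon> t) (\<epsilon> t) > 0) \<and> (\<forall>s t. s \<noteq> t \<longrightarrow> cov M (\<epsilon> s) (\<epsilon> t) = 0)"

definition stationary_AR2 :: "'a measure \<Rightarrow> (int \<Rightarrow> 'a \<Rightarrow> real) \<Rightarrow> bool" where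
  "stationary_AR2 M Z \<longleftrightarrow> weakly_stationary M Z \<and>
     (\<exists>a1 a2 \<epsilon>. white_noise M \<epsilon> \<and>
        (\<forall>t. AE x in M. Z t x = a1 * Z (t - 1) x + a2 * Z (t - 2) x + \<epsilon> t x))"

definition normalized_spectral_density ::
    "'a measure \<Rightarrow> (int \<Rightarrow> 'a \<Rightarrow> real) \<Rightarrow> (real \<Rightarrow> real) \<Rightarrow> bool" where
  "normalized_spectral_density M Z f \<longleftrightarrow> f \<in> F_all \<and> cov M (Z 0) (Z 0) > 0 \<and>
     (\<forall>h. complex_of_real (cov M (Z h) (Z 0)) = of_real (cov M (Z 0) (Z 0)) * fourier_coeff f h)"

text \<open>
  A process determines its spectral density only almost everywhere.  Continuity selects the usual
  version, which for autoregressive processes is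
  \<open>f(\<nu>) = c |1 - a\<^sub>1 exp(-\<i>\<nu>) - a\<^sub>2 exp(-2\<i>\<nu>)|\<^sup>-\<^sup>2\<close>.
  Realizing the process on the sequence space \<open>int \<Rightarrow> real\<close> is no restriction,
  since only the law of \<open>Z\<close> matters and \<open>\<epsilon>\<close> is almost surely a function of \<open>Z\<close>.
\<close>
definition F_AR2 :: "(real \<Rightarrow> real) set" where
  "F_AR2 = {f \<in> F_all. continuous_on {-pi..pi} f \<and>
     (\<exists>(M :: (int \<Rightarrow> real) measure) Z. stationary_AR2 M Z \<and> normalized_spectral_density M Z f)}"

definition F_AR2_ext :: "(real \<Rightarrow> real) set" where
  "F_AR2_ext = {restrict (\<lambda>\<nu>. c1 * f \<nu> + c2 / (2 * pi)) {-pi..pi} |f c1 c2.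
     f \<in> F_AR2 \<and> 0 \<le> c1 \<and> 0 \<le> c2 \<and> c1 + c2 = 1}"


section \<open>Gaussian measures\<close>

text \<open>
  \<open>N(\<mu>, A)\<close> as the law of \<open>\<mu> + B Z\<close>, where \<open>Z\<close> has independent standard normal coordinates and
  \<open>B B' = A\<close>.  For nonnegative definite symmetric \<open>A\<close> such a \<open>B\<close> exists and the law does not depend on its choice.
\<close>
definition gaussian :: "real^'n \<Rightarrow> real^'n^'n \<Rightarrow> (real^'n) measure" where
  "gaussian \<mu> A =
     distr (density lborel (\<lambda>z. ennreal (\<Prod>i\<in>UNIV. std_normal_density (z $ i)))) borel
       (\<lambda>z. \<mu> + (SOME B :: real^'n^'n. B ** transpose B = A) *v z)"


section \<open>Estimators and test statistic\<close>

text \<open>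
  \<open>\<beta>\<close> and \<open>\<Omega>\<close> are total functions in HOL; their values on \<open>N\<close> are irrelevant.
\<close>
definition estimator_conditions ::
    "real^'k^'n \<Rightarrow> (real^'n \<Rightarrow> real^'k) \<Rightarrow> (real^'n \<Rightarrow> real^'q^'q) \<Rightarrow> (real^'n) set \<Rightarrow> bool" where
  "estimator_conditions X \<beta> \<Omega> N \<longleftrightarrow>
     closed N \<and> N \<in> null_sets lborel \<and> continuous_on (- N) \<beta> \<and> continuous_on (- N) \<Omega> \<and>
     (\<forall>y. y \<notin> N \<longrightarrow> transpose (\<Omega> y) = \<Omega> y) \<and>
     (\<forall>y \<delta> \<eta>. y \<notin> N \<and> \<delta> \<noteq> 0 \<longrightarrow> \<delta> *\<^sub>R y + X *v \<eta> \<notin> N) \<and>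
     (\<forall>y \<delta> \<eta>. y \<notin> N \<and> \<delta> \<noteq> 0 \<longrightarrow>
        \<beta> (\<delta> *\<^sub>R y + X *v \<eta>) = \<delta> *\<^sub>R \<beta> y + \<eta> \<and>
        \<Omega> (\<delta> *\<^sub>R y + X *v \<eta>) = \<delta>\<^sup>2 *\<^sub>R \<Omega> y) \<and>
     (AE y in lborel. y \<notin> N \<longrightarrow> invertible (\<Omega> y))"

definition Nstar :: "(real^'n \<Rightarrow> real^'q^'q) \<Rightarrow> (real^'n) set \<Rightarrow> (real^'n) set" where
  "Nstar \<Omega> N = N \<union> {y. y \<notin> N \<and> det (\<Omega> y) = 0}"

definition quad_form :: "real^'q^'q \<Rightarrow> real^'q \<Rightarrow> real" where
  "quad_form A v = v \<bullet> (A *v v)"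

definition nonneg_definite :: "real^'q^'q \<Rightarrow> bool" where
  "nonneg_definite A \<longleftrightarrow> transpose A = A \<and> (\<forall>v. 0 \<le> quad_form A v)"

definition T_stat ::
    "real^'k^'q \<Rightarrow> real^'q \<Rightarrow> (real^'n \<Rightarrow> real^'k) \<Rightarrow> (real^'n \<Rightarrow> real^'q^'q) \<Rightarrow> (real^'n) set
      \<Rightarrow> real^'n \<Rightarrow> real" where
  "T_stat R r \<beta> \<Omega> N y =
     (if y \<in> Nstar \<Omega> N then 0 else quad_form (matrix_inv (\<Omega> y)) (R *v \<beta> y - r))"

text \<open>\<open>xi_bar X R \<Omega> N \<omega> x y\<close> is the value of \<open>\<xi>\<^sub>\<omega>(x)\<close> when \<open>\<^bold>G = y\<close>.\<close>
definition xi_bar ::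
    "real^'k^'n::{finite,linorder} \<Rightarrow> real^'k^'q \<Rightarrow> ((real, 'n) vec \<Rightarrow> real^'q^'q) \<Rightarrow>
      (real, 'n) vec set \<Rightarrow> real \<Rightarrow> real^2 \<Rightarrow> (real, 'n) vec \<Rightarrow> real" where
  "xi_bar X R \<Omega> N \<omega> x y =
     (if y \<in> Nstar \<Omega> N then 0
      else quad_form (matrix_inv (\<Omega> y)) (R *v ols X (trendE (rho X R \<omega>) \<omega> *v x)))"

end

theory Submission
  imports Defs
begin

text \<open>
  Since \<open>R\<close> has a nonzero column among the first two, \<open>\<rho>(\<omega>) = 0\<close>, and \<open>E = E\<^bsub>n,0\<^esub>(\<omega>)\<close> has its columns
  in the column space of \<open>X\<close>.  AR(2) densities with a spike at \<open>\<omega>\<close> make \<open>\<Sigma>(f)\<close> converge to \<open>E E'\<close>; mixing in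
  white noise with weight \<open>c\<close> gives \<open>\<Sigma> \<approx> (1 - c) E E' + c I\<close> with an error that is arbitrarily small
  compared with \<open>c\<close>.  Such a matrix factors as \<open>B B'\<close> with \<open>B = \<surd>c I + X K\<close> up to a factor close to \<open>I\<close>,
  and \<open>X K \<rightarrow> E V\<close> as \<open>c \<rightarrow> 0\<close>, where \<open>V V' = I\<close>.  By equivariance \<open>T(\<mu>\<^sub>0 + \<sigma> B z)\<close> then behaves like
  \<open>c\<^sup>-\<^sup>1\<close> times \<open>\<xi>\<^sub>\<omega>(V z)\<close> with \<open>\<^bold>G = z\<close>, so it tends to infinity wherever the latter is positive, and
  Fatou's lemma bounds the supremum from below by the Gaussian measure of \<open>{z. \<xi>\<^sub>\<omega>(V z) \<ge> 0}\<close>.  This measure is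
  \<open>K(\<omega>)\<close>: \<open>\<xi>\<^sub>\<omega>(x)\<close> depends on \<open>\<^bold>G\<close> only modulo the columns of \<open>X\<close>, and a rotation of \<open>\<real>\<^sup>2 \<times> \<real>\<^sup>n\<close>
  exchanges \<open>x\<close> with \<open>V \<^bold>G\<close>.
\<close>

section \<open>Standard Gaussian measures\<close>

text \<open>Stated on an arbitrary Euclidean space and through the norm: invariance under orthogonal
  maps is then visible, and the same density serves for vectors and for pairs of vectors.\<close>

definition gauss_density :: "'a::euclidean_space \<Rightarrow> real" where
  "gauss_density x = exp (- (norm x)\<^sup>2 / 2) / sqrt (2 * pi) ^ DIM('a)"

definition std_gauss :: "'a::euclidean_space measure" where
  "std_gauss = density lborel (\<lambda>x. ennreal (gauss_density x))"

lemma gauss_density_measurable [measurable]: "gauss_density \<in> borel_measurable borel"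
  unfolding gauss_density_def by measurable

lemma gauss_density_nonneg [simp]: "0 \<le> gauss_density x"
  by (simp add: gauss_density_def)

lemma sets_std_gauss [simp, measurable_cong]: "sets std_gauss = sets borel"
  by (simp add: std_gauss_def)

lemma space_std_gauss [simp]: "space std_gauss = UNIV"
  by (simp add: std_gauss_def)

lemma gauss_density_eq_prod:
  "gauss_density (x::'a::euclidean_space) = (\<Prod>b\<in>Basis. std_normal_density (x \<bullet> b))"
proof -
  have "(\<Prod>b\<in>Basis. std_normal_density (x \<bullet> b))
      = (1 / sqrt (2 * pi)) ^ DIM('a) * exp (\<Sum>b\<in>Basis. - (x \<bullet> b)\<^sup>2 / 2)"
    unfolding std_normal_density_def prod.distrib by (simp add: exp_sum)
  also have "(\<Sum>b\<in>Basis. - (x \<bullet> b)\<^sup>2 / 2) = - (norm x)\<^sup>2 / 2"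
    by (simp add: norm_eq_sqrt_inner euclidean_inner[of x x] power2_eq_square sum_negf
        sum_divide_distrib sum_nonneg)
  finally show ?thesis
    by (simp add: gauss_density_def power_divide)
qed

lemma nn_integral_gauss_density:
  "(\<integral>\<^sup>+x. ennreal (gauss_density (x::'a::euclidean_space)) \<partial>lborel) = 1"
proof -
  have "(\<integral>\<^sup>+x. ennreal (gauss_density (x::'a)) \<partial>lborel)
      = (\<integral>\<^sup>+x. (\<Prod>b\<in>Basis. ennreal (std_normal_density ((x::'a) \<bullet> b))) \<partial>lborel)"
    by (simp add: gauss_density_eq_prod prod_ennreal)
  also have "\<dots> = (\<Prod>b\<in>(Basis::'a set). \<integral>\<^sup>+x. ennreal (std_normal_density x) \<partial>lborel)"
    by (rule nn_integral_lborel_prod) auto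
  also have "(\<integral>\<^sup>+x. ennreal (std_normal_density x) \<partial>lborel) = 1"
    using prob_space.emeasure_space_1[OF prob_space_normal_density[of 1 0]]
    by (simp add: emeasure_density)
  finally show ?thesis by simp
qed

lemma prob_space_std_gauss: "prob_space (std_gauss :: 'a::euclidean_space measure)"
  by (rule prob_spaceI) (simp add: std_gauss_def emeasure_density nn_integral_gauss_density)

lemma AE_std_gauss_iff: "(AE x in std_gauss. P x) \<longleftrightarrow> (AE x in lborel. P x)"
  unfolding std_gauss_def by (subst AE_density) (auto simp: gauss_density_def)

section \<open>Invariance of Lebesgue and Gaussian measure under isometries\<close>

lemma nn_integral_lborel_translate:
  fixes f :: "'a::euclidean_space \<Rightarrow> ennreal"
  assumes [measurable]: "f \<in> borel_measurable borel"
  shows "(\<integral>\<^sup>+x. f (a + x) \<partial>lborel) = (\<integral>\<^sup>+x. f x \<partial>lborel)"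
proof -
  have "(\<integral>\<^sup>+x. f x \<partial>distr lborel borel ((+) a)) = (\<integral>\<^sup>+x. f (a + x) \<partial>lborel)"
    by (subst nn_integral_distr) auto
  then show ?thesis by (simp add: lborel_distr_plus)
qed

lemma nn_integral_lborel_reflect:
  fixes f :: "'a::euclidean_space \<Rightarrow> ennreal"
  assumes [measurable]: "f \<in> borel_measurable borel"
  shows "(\<integral>\<^sup>+x. f (a - x) \<partial>lborel) = (\<integral>\<^sup>+x. f x \<partial>lborel)"
proof -
  have "(\<integral>\<^sup>+x. f x \<partial>lborel) = (\<integral>\<^sup>+x. f x \<partial>distr lborel borel (\<lambda>x. a + (-1) *\<^sub>R x))"
    by (subst lborel_affine[of "-1" a]) (auto simp: density_1)
  also have "\<dots> = (\<integral>\<^sup>+x. f (a - x) \<partial>lborel)"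
    by (subst nn_integral_distr) auto
  finally show ?thesis ..
qed

text \<open>
  Uniqueness of the translation invariant measure: with \<open>g\<close> the Gaussian density, compare
  \<open>\<integral>\<integral> 1\<^sub>A(Q x) g(y) dy dx\<close> with its image under the substitutions \<open>y \<rightarrow> y + Q x\<close> and then \<open>x \<rightarrow> x - Q\<^sup>-\<^sup>1 y\<close>.
\<close>
lemma distr_lborel_orthogonal:
  fixes Q :: "'a::euclidean_space \<Rightarrow> 'a"
  assumes Q: "orthogonal_transformation Q"
  shows "distr lborel borel Q = lborel"
proof (rule measure_eqI)
  have lin: "linear Q" and nrm: "\<And>x. norm (Q x) = norm x"
    using Q by (auto simp: orthogonal_transformation)
  have Qm [measurable]: "Q \<in> borel_measurable borel"
    by (intro borel_measurable_continuous_onI linear_continuous_on linear_conv_bounded_linear[THEN iffD1] lin)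
  obtain Q' where Q': "\<And>y. Q (Q' y) = y"
    using orthogonal_transformation_surj[OF Q] by (metis surjD)
  have g: "gauss_density (Q x) = gauss_density x" for x
    by (simp add: gauss_density_def nrm)
  fix A assume "A \<in> sets (distr lborel borel Q)"
  then have A [measurable]: "A \<in> sets borel" by simp
  let ?g = "\<lambda>x::'a. ennreal (gauss_density x)"
  have "emeasure (distr lborel borel Q) A = (\<integral>\<^sup>+x. indicator A (Q x) \<partial>lborel)"
    by (subst nn_integral_distr[symmetric, of Q lborel borel]) auto
  also have "\<dots> = (\<integral>\<^sup>+x. indicator A (Q x) * (\<integral>\<^sup>+y. ?g (Q x + y) \<partial>lborel) \<partial>lborel)"
    by (subst nn_integral_lborel_translate) (auto simp: nn_integral_gauss_density)
  also have "\<dots> = (\<integral>\<^sup>+x. \<integral>\<^sup>+y. indicator A (Q x) * ?g (Q x + y) \<partial>lborel \<partial>lborel)"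
    by (simp add: nn_integral_cmult)
  also have "\<dots> = (\<integral>\<^sup>+y. \<integral>\<^sup>+x. indicator A (Q x) * ?g (Q x + y) \<partial>lborel \<partial>lborel)"
    by (rule lborel_pair.Fubini') measurable
  also have "\<dots> = (\<integral>\<^sup>+y. \<integral>\<^sup>+x. indicator A (Q (Q' (-y) + x)) * ?g (Q (Q' (-y) + x) + y) \<partial>lborel \<partial>lborel)"
    by (intro nn_integral_cong nn_integral_lborel_translate[symmetric]) measurable
  also have "\<dots> = (\<integral>\<^sup>+y. \<integral>\<^sup>+x. indicator A (Q x - y) * ?g x \<partial>lborel \<partial>lborel)"
    by (simp add: linear_add[OF lin] Q' g)
  also have "\<dots> = (\<integral>\<^sup>+x. \<integral>\<^sup>+y. indicator A (Q x - y) * ?g x \<partial>lborel \<partial>lborel)"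
    by (rule lborel_pair.Fubini'[symmetric]) measurable
  also have "\<dots> = (\<integral>\<^sup>+x. (\<integral>\<^sup>+y. indicator A (Q x - y) \<partial>lborel) * ?g x \<partial>lborel)"
    by (simp add: nn_integral_multc)
  also have "\<dots> = (\<integral>\<^sup>+x. emeasure lborel A * ?g x \<partial>lborel)"
    by (subst nn_integral_lborel_reflect) auto
  also have "\<dots> = emeasure lborel A"
    by (simp add: nn_integral_cmult nn_integral_gauss_density)
  finally show "emeasure (distr lborel borel Q) A = emeasure lborel A" .
qed simp

lemma distr_std_gauss_orthogonal:
  fixes Q :: "'a::euclidean_space \<Rightarrow> 'a"
  assumes Q: "orthogonal_transformation Q"
  shows "distr std_gauss borel Q = std_gauss"
proof -
  have lin: "linear Q" and nrm: "\<And>x. norm (Q x) = norm x"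
    using Q by (auto simp: orthogonal_transformation)
  have Qm [measurable]: "Q \<in> borel_measurable borel"
    by (intro borel_measurable_continuous_onI linear_continuous_on linear_conv_bounded_linear[THEN iffD1] lin)
  have "(std_gauss :: 'a measure) = density (distr lborel borel Q) gauss_density"
    by (simp add: distr_lborel_orthogonal[OF Q] std_gauss_def)
  also have "\<dots> = distr (density lborel (\<lambda>x. gauss_density (Q x))) borel Q"
    by (subst density_distr) auto
  also have "\<dots> = distr std_gauss borel Q"
    by (simp add: gauss_density_def nrm std_gauss_def)
  finally show ?thesis ..
qed

lemma std_gauss_pair:
  "(std_gauss \<Otimes>\<^sub>M std_gauss :: ('a::euclidean_space \<times> 'b::euclidean_space) measure) = std_gauss"
proof -
  interpret G: prob_space "std_gauss :: 'b measure" by (rule prob_space_std_gauss)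
  have "(std_gauss \<Otimes>\<^sub>M std_gauss :: ('a \<times> 'b) measure)
      = density (lborel \<Otimes>\<^sub>M lborel) (\<lambda>(x, y). ennreal (gauss_density x) * ennreal (gauss_density y))"
    using G.sigma_finite_measure_axioms unfolding std_gauss_def
    by (intro pair_measure_density) (auto intro: lborel.sigma_finite_measure_axioms)
  also have "\<dots> = std_gauss"
    unfolding lborel_prod std_gauss_def
    by (intro arg_cong2[where f = density] refl ext)
       (auto simp: gauss_density_def norm_Pair ennreal_mult[symmetric] power_add exp_add[symmetric] field_simps)
  finally show ?thesis .
qed

section \<open>Normal laws as linear images of the standard Gaussian measure\<close>

lemma prod_std_normal_density_vec:
  "(\<Prod>i\<in>UNIV. std_normal_density (z $ i)) = gauss_density (z :: real^'n)"
proof -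
  have "(Basis :: (real^'n) set) = (\<lambda>i. axis i 1) ` UNIV"
    by (auto simp: Basis_vec_def)
  moreover have "(\<Prod>b\<in>(\<lambda>i. axis i 1) ` UNIV. std_normal_density (z \<bullet> b))
      = (\<Prod>i\<in>UNIV. std_normal_density (z $ i))"
    by (subst prod.reindex) (auto simp: inj_on_def axis_eq_axis inner_axis)
  ultimately show ?thesis
    unfolding gauss_density_eq_prod by metis
qed

lemma orthogonal_transformation_matrix_mult:
  fixes Q :: "real^'n^'n"
  assumes "Q ** transpose Q = mat 1"
  shows "orthogonal_transformation ((*v) Q)"
proof -
  have "transpose Q ** Q = mat 1"
    using assms by (simp only: matrix_left_right_inverse)
  then show ?thesis
    by (simp add: orthogonal_transformation_matrix orthogonal_matrix)
qed

text \<open>The root \<open>C\<close> picked by \<open>gaussian\<close> equals \<open>B ** Q\<close>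
  with \<open>Q\<close> orthogonal, because \<open>B\<close> is invertible. Rotation invariance of
  the standard Gaussian measure absorbs \<open>Q\<close>, so the choice does not matter.\<close>

lemma gaussian_eq_distr:
  fixes B :: "real^'n^'n"
  assumes B: "invertible B"
  shows "gaussian \<mu> (B ** transpose B) = distr std_gauss borel (\<lambda>z. \<mu> + B *v z)"
proof -
  define C :: "real^'n^'n" where "C = (SOME C. C ** transpose C = B ** transpose B)"
  have C: "C ** transpose C = B ** transpose B"
    unfolding C_def by (rule someI[of _ B]) simp
  obtain B' where B': "B ** B' = mat 1" "B' ** B = mat 1"
    using B by (auto simp: invertible_def)
  define Q where "Q = B' ** C"
  have "Q ** transpose Q = B' ** (C ** transpose C) ** transpose B'"
    by (simp add: Q_def matrix_transpose_mul matrix_mul_assoc)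
  also have "\<dots> = (B' ** B) ** transpose (B' ** B)"
    by (simp add: C matrix_transpose_mul matrix_mul_assoc)
  finally have "Q ** transpose Q = mat 1"
    by (simp add: B' transpose_mat)
  then have Q: "distr std_gauss borel ((*v) Q) = std_gauss"
    by (intro distr_std_gauss_orthogonal orthogonal_transformation_matrix_mult)
  have C': "C = B ** Q"
    by (simp add: Q_def matrix_mul_assoc B')
  have [measurable]: "(\<lambda>z. M *v z) \<in> borel_measurable borel" for M :: "real^'n^'n"
    by (intro borel_measurable_continuous_onI linear_continuous_on) simp
  have "distr std_gauss borel (\<lambda>z. \<mu> + B *v z) = distr (distr std_gauss borel ((*v) Q)) borel (\<lambda>z. \<mu> + B *v z)"
    by (simp add: Q)
  also have "\<dots> = distr std_gauss borel (\<lambda>z. \<mu> + C *v z)"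
    by (subst distr_distr) (auto simp: o_def C' matrix_vector_mul_assoc)
  finally show ?thesis
    by (simp add: gaussian_def C_def[symmetric] prod_std_normal_density_vec std_gauss_def)
qed

lemma gaussian_0_mat_1: "gaussian 0 (mat 1 :: real^'n^'n) = std_gauss"
proof -
  have "gaussian 0 (mat 1 :: real^'n^'n) = distr std_gauss borel (\<lambda>z. z)"
    using gaussian_eq_distr[of "mat 1 :: real^'n^'n" 0] by (auto simp: invertible_def intro: matrix_mul_lid)
  also have "\<dots> = std_gauss"
    by (rule measure_eqI) (auto simp: emeasure_distr)
  finally show ?thesis .
qed

text \<open>As \<open>V\<close> has orthonormal rows, \<open>y\<close> splits into
  \<open>V' V y\<close> and a part orthogonal to it. The map \<open>\<Phi>\<close> puts
  \<open>x\<close> in place of the coordinates \<open>V y\<close> and moves \<open>- V y\<close> to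
  the first slot, so it is an isometry of the product space. Afterwards \<open>V\<close> applied to
  the second slot gives \<open>x\<close>, while the second slot has only moved along the range of
  \<open>V'\<close>, which \<open>Q\<close> cannot see.\<close>

lemma std_gauss_swap:
  fixes V :: "real^'n^'m" and Q :: "real^'m \<Rightarrow> real^'n \<Rightarrow> bool"
  assumes V: "V ** transpose V = mat 1"
    and Q: "{p. Q (fst p) (snd p)} \<in> sets borel" "{z. Q (V *v z) z} \<in> sets borel"
    and inv: "\<And>x y w. Q x (y + transpose V *v w) \<longleftrightarrow> Q x y"
  shows "emeasure std_gauss {z. Q (V *v z) z} = emeasure std_gauss {p. Q (fst p) (snd p)}"
proof -
  define \<Phi> :: "(real^'m) \<times> (real^'n) \<Rightarrow> (real^'m) \<times> (real^'n)" where
    "\<Phi> p = (- (V *v snd p), snd p + transpose V *v fst p - transpose V *v (V *v snd p))" for p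
  have VV: "V *v (transpose V *v x) = x" for x
    by (simp only: matrix_vector_mul_assoc V) simp
  have adj: "(transpose V *v x) \<bullet> y = x \<bullet> (V *v y)" for x y
    by (simp add: dot_lmul_matrix)
  have lin: "linear \<Phi>"
    unfolding \<Phi>_def
    by (auto simp: linear_iff matrix_vector_right_distrib matrix_vector_mult_scaleR scaleR_right_distrib
        scaleR_diff_right simp del: transpose_matrix_vector)
  have "orthogonal_transformation \<Phi>"
    unfolding orthogonal_transformation
  proof (intro conjI allI lin)
    fix p :: "(real^'m) \<times> (real^'n)"
    obtain x y where p: "p = (x, y)" by force
    have "(norm (\<Phi> p))\<^sup>2 = (V *v y) \<bullet> (V *v y)
        + (y + transpose V *v x - transpose V *v (V *v y)) \<bullet> (y + transpose V *v x - transpose V *v (V *v y))"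
      by (simp add: \<Phi>_def p norm_Pair dot_square_norm)
    also have "\<dots> = x \<bullet> x + y \<bullet> y"
      by (simp add: inner_add_left inner_add_right inner_diff_left inner_diff_right adj VV
          inner_commute[of y "transpose V *v _"] inner_commute[of "V *v y" x] del: transpose_matrix_vector)
    also have "\<dots> = (norm p)\<^sup>2"
      by (simp add: p norm_Pair dot_square_norm)
    finally show "norm (\<Phi> p) = norm p"
      by (simp add: power2_eq_iff_nonneg)
  qed
  then have distr: "distr std_gauss borel \<Phi> = std_gauss"
    by (rule distr_std_gauss_orthogonal)
  have [measurable]: "\<Phi> \<in> borel_measurable borel"
    by (intro borel_measurable_continuous_onI linear_continuous_on linear_conv_bounded_linear[THEN iffD1] lin)
  interpret G: prob_space "std_gauss :: (real^'m) measure"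
    by (rule prob_space_std_gauss)
  interpret H: prob_space "std_gauss :: (real^'n) measure"
    by (rule prob_space_std_gauss)
  let ?A = "{z. Q (V *v z) z}"
  have "emeasure std_gauss ?A = emeasure (std_gauss \<Otimes>\<^sub>M std_gauss :: ((real^'m) \<times> (real^'n)) measure) (UNIV \<times> ?A)"
    using Q(2) G.emeasure_space_1 by (subst H.emeasure_pair_measure_Times) auto
  also have "\<dots> = emeasure (distr std_gauss borel \<Phi>) (UNIV \<times> ?A)"
    by (simp add: std_gauss_pair distr)
  also have "\<dots> = emeasure std_gauss (\<Phi> -` (UNIV \<times> ?A))"
    using Q(2) by (subst emeasure_distr) (auto intro!: borel_Times)
  also have "\<Phi> -` (UNIV \<times> ?A) = {p. Q (fst p) (snd p)}"
  proof -
    have "Q (V *v snd (\<Phi> p)) (snd (\<Phi> p)) \<longleftrightarrow> Q (fst p) (snd p)" for p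
    proof -
      have "V *v snd (\<Phi> p) = fst p"
        by (simp add: \<Phi>_def matrix_vector_mult_diff_distrib matrix_vector_right_distrib VV del: transpose_matrix_vector)
      moreover have "snd (\<Phi> p) = snd p + transpose V *v (fst p - V *v snd p)"
        by (simp add: \<Phi>_def matrix_vector_mult_diff_distrib del: transpose_matrix_vector)
      ultimately show ?thesis by (simp only: inv)
    qed
    then show ?thesis
      by (simp add: set_eq_iff mem_Times_iff del: split_paired_All)
  qed
  finally show ?thesis .
qed


section \<open>Autoregressive spectral densities\<close>

text \<open>The sine integral changes sign under reflection and hence vanishes, which leaves a real
  cosine integral.\<close>

lemma fourier_coeff_even:
  assumes cont: "continuous_on {-pi..pi} f" and even: "\<And>\<nu>. \<nu> \<in> {-pi..pi} \<Longrightarrow> f (- \<nu>) = f \<nu>"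
  shows "fourier_coeff f h = complex_of_real (integral {-pi..pi} (\<lambda>\<nu>. cos (of_int h * \<nu>) * f \<nu>))"
proof -
  let ?c = "\<lambda>\<nu>. cos (of_int h * \<nu>) * f \<nu>" and ?s = "\<lambda>\<nu>. sin (of_int h * \<nu>) * f \<nu>"
  have c: "?c integrable_on {-pi..pi}" and s: "?s integrable_on {-pi..pi}"
    by (intro integrable_continuous_real continuous_intros cont)+
  have "integral {-pi..pi} ?s = integral {-pi..pi} (\<lambda>\<nu>. ?s (- \<nu>))"
    using Henstock_Kurzweil_Integration.integral_reflect_real[where a = "-pi" and b = pi and f = ?s] by (simp only: minus_minus)
  also have "\<dots> = integral {-pi..pi} (\<lambda>\<nu>. - ?s \<nu>)"
    by (rule integral_cong) (simp add: even)
  finally have s0: "integral {-pi..pi} ?s = 0"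
    by simp
  have "((\<lambda>\<nu>. complex_of_real (?c \<nu>) - \<i> * complex_of_real (?s \<nu>))
      has_integral (complex_of_real (integral {-pi..pi} ?c) - \<i> * complex_of_real (integral {-pi..pi} ?s))) {-pi..pi}"
    using has_integral_linear[OF integrable_integral[OF c] bounded_linear_of_real]
      has_integral_linear[OF integrable_integral[OF s] bounded_linear_of_real]
    by (intro has_integral_diff has_integral_mult_right) (simp_all only: o_def)
  moreover have "exp (- (\<i> * of_int h * complex_of_real \<nu>)) * complex_of_real (f \<nu>)
      = complex_of_real (?c \<nu>) - \<i> * complex_of_real (?s \<nu>)" for \<nu>
  proof -
    have "- (\<i> * of_int h * complex_of_real \<nu>) = \<i> * complex_of_real (- (of_int h * \<nu>))" by simp
    then show ?thesis
      by (simp only: cis_conv_exp[symmetric]) (simp add: complex_eq_iff)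
  qed
  ultimately show ?thesis
    unfolding fourier_coeff_def by (simp add: s0 integral_unique)
qed

lemma integral_cos_int:
  "integral {-pi..pi} (\<lambda>\<nu>. cos (of_int h * \<nu>)) = (if h = 0 then 2 * pi else 0)"
proof (cases "h = 0")
  case False
  have "((\<lambda>\<nu>. cos (of_int h * \<nu>)) has_integral
      (sin (of_int h * pi) / of_int h - sin (of_int h * (- pi)) / of_int h)) {-pi..pi}"
    using False
    by (intro fundamental_theorem_of_calculus)
       (auto intro!: derivative_eq_intros simp flip: has_real_derivative_iff_has_vector_derivative)
  with False show ?thesis
    by (simp add: integral_unique sin_npi_int mult.commute)
qed simp

text \<open>
  \<open>\<surd>2 cos(\<Lambda> t + \<phi>)\<close> with \<open>\<Lambda>\<close> distributed according to \<open>f\<close> and an independent uniform phase \<open>\<phi>\<close> has spectral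
  density \<open>f\<close>.  Four phases suffice for stationarity, and the process can be filtered pointwise in \<open>\<Lambda>\<close>:
  if \<open>f\<close> has the form of an AR(2) density, the innovations are uncorrelated without any series expansion.
\<close>
definition phases :: "real set" where "phases = {0, pi / 2, pi, - (pi / 2)}"

text \<open>The law of an independent pair of frequency and phase, placed on
  \<open>int \<Rightarrow> real\<close> because \<open>F_AR2\<close> asks for a measure on that
  space: coordinate 0 stores the frequency, every other coordinate the phase.\<close>

definition random_phase_measure :: "(real \<Rightarrow> real) \<Rightarrow> (int \<Rightarrow> real) measure" where
  "random_phase_measure f = distr
     (density lborel (\<lambda>\<nu>. ennreal (indicator {-pi..pi} \<nu> * f \<nu>)) \<Otimes>\<^sub>M measure_pmf (pmf_of_set phases))
     (\<Pi>\<^sub>M _\<in>UNIV. borel) (\<lambda>(\<nu>, \<phi>) i. if i = 0 then \<nu> else \<phi>)"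

section \<open>Second-order properties of the random phase process\<close>

context
  fixes f :: "real \<Rightarrow> real"
  assumes f: "f \<in> F_all" and cont: "continuous_on {-pi..pi} f"
begin

lemma spectral_density_measurable [measurable]:
  "(\<lambda>\<nu>. indicator {-pi..pi} \<nu> * f \<nu>) \<in> borel_measurable borel"
  using borel_measurable_continuous_on_indicator[OF _ cont] by simp

lemma spectral_density_nonneg: "0 \<le> indicator {-pi..pi} \<nu> * f \<nu>"
  using f by (auto simp: F_all_def indicator_def PiE_iff)

lemma lborel_integral_spectral_density:
  assumes "continuous_on {-pi..pi} g"
  shows "integrable lborel (\<lambda>\<nu>. indicator {-pi..pi} \<nu> * f \<nu> * g \<nu>)"
    and "(\<integral>\<nu>. indicator {-pi..pi} \<nu> * f \<nu> * g \<nu> \<partial>lborel) = integral {-pi..pi} (\<lambda>\<nu>. f \<nu> * g \<nu>)"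
proof -
  have "set_integrable lborel {-pi..pi} (\<lambda>\<nu>. f \<nu> * g \<nu>)"
    by (intro borel_integrable_atLeastAtMost' continuous_intros cont assms)
  from this set_borel_integral_eq_integral(2)[OF this]
  show "integrable lborel (\<lambda>\<nu>. indicator {-pi..pi} \<nu> * f \<nu> * g \<nu>)"
    and "(\<integral>\<nu>. indicator {-pi..pi} \<nu> * f \<nu> * g \<nu> \<partial>lborel) = integral {-pi..pi} (\<lambda>\<nu>. f \<nu> * g \<nu>)"
    by (simp_all add: set_integrable_def set_lebesgue_integral_def mult.assoc)
qed

lemma prob_space_spectral: "prob_space (density lborel (\<lambda>\<nu>. ennreal (indicator {-pi..pi} \<nu> * f \<nu>)))"
proof (rule prob_spaceI)
  have "(\<integral>\<^sup>+\<nu>. ennreal (indicator {-pi..pi} \<nu> * f \<nu>) \<partial>lborel)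
      = ennreal (\<integral>\<nu>. indicator {-pi..pi} \<nu> * f \<nu> \<partial>lborel)"
    using lborel_integral_spectral_density(1)[of "\<lambda>_. 1"] spectral_density_nonneg
    by (intro nn_integral_eq_integral) auto
  also have "\<dots> = 1"
    using lborel_integral_spectral_density(2)[of "\<lambda>_. 1"] f by (simp add: F_all_def)
  finally show "emeasure (density lborel (\<lambda>\<nu>. ennreal (indicator {-pi..pi} \<nu> * f \<nu>)))
      (space (density lborel (\<lambda>\<nu>. ennreal (indicator {-pi..pi} \<nu> * f \<nu>)))) = 1"
    by (simp add: emeasure_density)
qed

lemma random_phase_emb_measurable [measurable]:
  "(\<lambda>(\<nu>, \<phi>) i. if i = 0 then \<nu> else \<phi>) \<in>
     (density lborel (\<lambda>\<nu>. ennreal (indicator {-pi..pi} \<nu> * f \<nu>)) \<Otimes>\<^sub>M measure_pmf (pmf_of_set phases))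
     \<rightarrow>\<^sub>M (\<Pi>\<^sub>M (_::int)\<in>UNIV. borel)"
proof -
  have [measurable]: "(\<lambda>x::real. x) \<in> measure_pmf (pmf_of_set phases) \<rightarrow>\<^sub>M borel"
    by simp
  show ?thesis
    by (rule measurable_PiM_single') (auto simp: split_beta')
qed

lemma prob_space_random_phase: "prob_space (random_phase_measure f)"
proof -
  interpret prob_space "density lborel (\<lambda>\<nu>. ennreal (indicator {-pi..pi} \<nu> * f \<nu>))"
    by (rule prob_space_spectral)
  interpret pair_prob_space "density lborel (\<lambda>\<nu>. ennreal (indicator {-pi..pi} \<nu> * f \<nu>))"
      "measure_pmf (pmf_of_set phases)" ..
  show ?thesis
    unfolding random_phase_measure_def by (rule prob_space_distr) measurable
qed

lemma integral_random_phase: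
  assumes G: "(\<lambda>(\<nu>, \<phi>). G \<nu> \<phi>) \<in> borel_measurable borel"
    and bnd: "\<And>\<nu> \<phi>. \<bar>G \<nu> \<phi>\<bar> \<le> c"
  shows "integrable (random_phase_measure f) (\<lambda>w. G (w 0) (w 1))"
    and "(\<integral>w. G (w 0) (w 1) \<partial>random_phase_measure f)
      = (\<integral>\<nu>. indicator {-pi..pi} \<nu> * f \<nu> * ((\<Sum>\<phi>\<in>phases. G \<nu> \<phi>) / 4) \<partial>lborel)"
proof -
  let ?D = "density lborel (\<lambda>\<nu>. ennreal (indicator {-pi..pi} \<nu> * f \<nu>))"
  let ?P = "measure_pmf (pmf_of_set phases)"
  interpret prob_space ?D
    by (rule prob_space_spectral)
  interpret pair_prob_space ?D ?P ..
  interpret R: prob_space "random_phase_measure f"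
    by (rule prob_space_random_phase)
  have [measurable]: "(\<lambda>x::real. x) \<in> measure_pmf (pmf_of_set phases) \<rightarrow>\<^sub>M borel"
    by simp
  have G' [measurable]: "(\<lambda>(\<nu>, \<phi>). G \<nu> \<phi>) \<in> borel_measurable (borel \<Otimes>\<^sub>M borel)"
    using G by (simp add: borel_prod)
  have [measurable]: "(\<lambda>w. w i) \<in> random_phase_measure f \<rightarrow>\<^sub>M borel" for i
    unfolding random_phase_measure_def by simp
  have Gm: "(\<lambda>w. G (w 0) (w 1)) \<in> borel_measurable (\<Pi>\<^sub>M (_::int)\<in>UNIV. borel)"
    by measurable
  have meas [measurable]: "(\<lambda>p. G (fst p) (snd p)) \<in> borel_measurable (?D \<Otimes>\<^sub>M ?P)"
    by measurable
  have int: "integrable (?D \<Otimes>\<^sub>M ?P) (\<lambda>(\<nu>, \<phi>). G \<nu> \<phi>)"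
    by (rule integrable_const_bound[of _ c]) (auto simp: bnd split_beta')
  show "integrable (random_phase_measure f) (\<lambda>w. G (w 0) (w 1))"
    by (rule R.integrable_const_bound[of _ c]) (auto simp: bnd)
  have "(\<integral>w. G (w 0) (w 1) \<partial>random_phase_measure f) = (\<integral>p. G (fst p) (snd p) \<partial>(?D \<Otimes>\<^sub>M ?P))"
    unfolding random_phase_measure_def
    by (subst integral_distr[OF _ Gm]) (auto simp: split_beta')
  also have "\<dots> = (\<integral>\<nu>. (\<integral>\<phi>. G \<nu> \<phi> \<partial>?P) \<partial>?D)"
    using integral_fst'[OF int] by (simp add: split_beta')
  also have "\<dots> = (\<integral>\<nu>. (\<Sum>\<phi>\<in>phases. G \<nu> \<phi>) / 4 \<partial>?D)"
  proof -
    have ne: "pi \<noteq> - (pi / 2)"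
      using pi_gt_zero by linarith
    have "card phases = 4" "finite phases" "phases \<noteq> {}"
      by (auto simp: phases_def card_insert_if ne)
    then show ?thesis
      by (simp add: integral_pmf_of_set)
  qed
  also have "\<dots> = (\<integral>\<nu>. indicator {-pi..pi} \<nu> * f \<nu> * ((\<Sum>\<phi>\<in>phases. G \<nu> \<phi>) / 4) \<partial>lborel)"
    by (subst integral_density) (auto simp: spectral_density_nonneg)
  finally show "(\<integral>w. G (w 0) (w 1) \<partial>random_phase_measure f)
      = (\<integral>\<nu>. indicator {-pi..pi} \<nu> * f \<nu> * ((\<Sum>\<phi>\<in>phases. G \<nu> \<phi>) / 4) \<partial>lborel)" .
qed


text \<open>For a fixed frequency, opposite phases cancel, so the mean is zero. Averaging a product
  over the four quarter turns leaves half the squared amplitude times the cosine of the lag; the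
  factor \<open>sqrt 2\<close> removes the half. Thus covariances depend on the lag only, and a
  filter acts by changing the amplitudes \<open>C\<close> and \<open>S\<close>.\<close>

lemma random_phase_wave:
  fixes C S :: "real \<Rightarrow> real" and U :: "int \<Rightarrow> (int \<Rightarrow> real) \<Rightarrow> real"
  assumes U_def: "\<And>t w. U t w = sqrt 2 * (C (w 0) * cos (w 0 * of_int t + w 1)
      + S (w 0) * sin (w 0 * of_int t + w 1))"
    and C: "continuous_on UNIV C" and S: "continuous_on UNIV S"
    and bnd: "\<And>\<nu>. \<bar>C \<nu>\<bar> \<le> c" "\<And>\<nu>. \<bar>S \<nu>\<bar> \<le> c"
  shows "(\<integral>w. U t w \<partial>random_phase_measure f) = 0"
    and "cov (random_phase_measure f) (U s) (U t)
      = integral {-pi..pi} (\<lambda>\<nu>. f \<nu> * (((C \<nu>)\<^sup>2 + (S \<nu>)\<^sup>2) * cos (of_int (s - t) * \<nu>)))"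
    and "weakly_stationary (random_phase_measure f) U"
proof -
  interpret R: prob_space "random_phase_measure f"
    by (rule prob_space_random_phase)
  define u where "u t \<nu> \<phi> = sqrt 2 * (C \<nu> * cos (\<nu> * of_int t + \<phi>) + S \<nu> * sin (\<nu> * of_int t + \<phi>))"
    for t :: int and \<nu> \<phi> :: real
  have U: "U t w = u t (w 0) (w 1)" for t w
    by (simp add: U_def u_def)
  have [measurable]: "C \<in> borel_measurable borel" "S \<in> borel_measurable borel"
    using C S by (auto intro: borel_measurable_continuous_onI)
  have um [measurable]: "(\<lambda>(\<nu>, \<phi>). u t \<nu> \<phi>) \<in> borel_measurable (borel \<Otimes>\<^sub>M borel)" for t
    unfolding u_def by measurable
  have c0: "0 \<le> c"
    using bnd(1)[of 0] by simp
  have ub: "\<bar>u t \<nu> \<phi>\<bar> \<le> sqrt 2 * (c + c)" for t \<nu> \<phi>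
  proof -
    have "\<bar>C \<nu> * cos (\<nu> * of_int t + \<phi>)\<bar> \<le> c * 1" "\<bar>S \<nu> * sin (\<nu> * of_int t + \<phi>)\<bar> \<le> c * 1"
      unfolding abs_mult by (intro mult_mono bnd c0; simp)+
    then have "\<bar>C \<nu> * cos (\<nu> * of_int t + \<phi>) + S \<nu> * sin (\<nu> * of_int t + \<phi>)\<bar> \<le> c + c"
      by linarith
    then show ?thesis
      by (simp add: u_def abs_mult)
  qed
  have sum_phases: "(\<Sum>\<phi>\<in>phases. G \<phi>) = G 0 + G (pi / 2) + G pi + G (- (pi / 2))" for G :: "real \<Rightarrow> real"
  proof -
    have ne: "pi \<noteq> - (pi / 2)"
      using pi_gt_zero by linarith
    show ?thesis
      by (simp add: phases_def ne add.assoc)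
  qed
  have cs: "cos (x + pi / 2) = - sin x" "sin (x + pi / 2) = cos x"
    "cos (x + - (pi / 2)) = sin x" "sin (x + - (pi / 2)) = - cos x" for x :: real
    by (simp_all add: cos_add sin_add cos_diff sin_diff)
  show mean: "(\<integral>w. U t w \<partial>random_phase_measure f) = 0" for t
  proof -
    have "(\<Sum>\<phi>\<in>phases. u t \<nu> \<phi>) = 0" for \<nu>
      unfolding sum_phases u_def cs by (simp add: algebra_simps)
    then show ?thesis
      using integral_random_phase(2)[of "u t", OF _ ub] um[of t] unfolding U by (simp add: borel_prod)
  qed
  have prodm: "(\<lambda>(\<nu>, \<phi>). u s \<nu> \<phi> * u t \<nu> \<phi>) \<in> borel_measurable borel" for s t
  proof -
    have "(\<lambda>(\<nu>, \<phi>). u s \<nu> \<phi> * u t \<nu> \<phi>) \<in> borel_measurable (borel \<Otimes>\<^sub>M borel)"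
      by measurable
    then show ?thesis
      by (simp add: borel_prod)
  qed
  have prodb: "\<bar>u s \<nu> \<phi> * u t \<nu> \<phi>\<bar> \<le> (sqrt 2 * (c + c)) * (sqrt 2 * (c + c))" for s t \<nu> \<phi>
    unfolding abs_mult using c0 by (intro mult_mono ub) auto
  show cov: "cov (random_phase_measure f) (U s) (U t)
      = integral {-pi..pi} (\<lambda>\<nu>. f \<nu> * (((C \<nu>)\<^sup>2 + (S \<nu>)\<^sup>2) * cos (of_int (s - t) * \<nu>)))" for s t
  proof -
    have "(\<Sum>\<phi>\<in>phases. u s \<nu> \<phi> * u t \<nu> \<phi>) / 4 = ((C \<nu>)\<^sup>2 + (S \<nu>)\<^sup>2) * cos (of_int (s - t) * \<nu>)" for \<nu>
    proof -
      have r: "sqrt 2 * a * (sqrt 2 * b) = 2 * (a * b)" for a b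
        by simp
      have "cos (of_int (s - t) * \<nu>) = cos (\<nu> * of_int s - \<nu> * of_int t)"
        by (simp add: algebra_simps)
      then show ?thesis
        unfolding sum_phases u_def cs r cos_diff
        by (simp add: field_simps power2_eq_square)
    qed
    moreover have "cov (random_phase_measure f) (U s) (U t)
        = (\<integral>w. u s (w 0) (w 1) * u t (w 0) (w 1) \<partial>random_phase_measure f)"
      unfolding cov_def mean by (simp add: U)
    ultimately show ?thesis
      using integral_random_phase(2)[of "\<lambda>\<nu> \<phi>. u s \<nu> \<phi> * u t \<nu> \<phi>", OF prodm prodb]
      by (subst lborel_integral_spectral_density(2)[symmetric])
         (auto intro!: continuous_intros continuous_on_subset[OF C] continuous_on_subset[OF S])
  qed
  have [measurable]: "(\<lambda>w. w i) \<in> random_phase_measure f \<rightarrow>\<^sub>M borel" for i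
    unfolding random_phase_measure_def by simp
  have "U t \<in> borel_measurable (random_phase_measure f)" for t
  unfolding U_def[abs_def] by measurable
  moreover have "integrable (random_phase_measure f) (\<lambda>w. (U t w)\<^sup>2)" for t
    using integral_random_phase(1)[of "\<lambda>\<nu> \<phi>. u t \<nu> \<phi> * u t \<nu> \<phi>", OF prodm prodb]
    by (simp add: U power2_eq_square)
  ultimately show "weakly_stationary (random_phase_measure f) U"
    by (simp add: weakly_stationary_def R.prob_space_axioms mean cov)
qed

text \<open>Subtracting the two lagged terms from the cosine wave gives a wave with amplitudes
  \<open>C\<close> and \<open>S\<close>. By hypothesis \<open>f\<close> times the squared amplitude
  is the constant \<open>c\<close>, so this difference has the covariances of white noise, and the
  recursion holds pointwise by the addition theorem.\<close>

lemma AR2_spectral_density: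
  assumes c: "c > 0"
    and ar: "\<And>\<nu>. \<nu> \<in> {-pi..pi} \<Longrightarrow>
      f \<nu> * ((1 - a1 * cos \<nu> - a2 * cos (2 * \<nu>))\<^sup>2 + (a1 * sin \<nu> + a2 * sin (2 * \<nu>))\<^sup>2) = c"
  shows "f \<in> F_AR2"
proof -
  define M where "M = random_phase_measure f"
  \<comment> \<open>The trivial factors 1 and 0 make the process an instance of
    \<open>random_phase_wave\<close>.\<close>
  define Z where "Z t w = sqrt 2 * (1 * cos (w 0 * of_int t + w 1) + 0 * sin (w 0 * of_int t + w 1))"
    for t :: int and w :: "int \<Rightarrow> real"
  define C where "C = (\<lambda>\<nu>. 1 - a1 * cos \<nu> - a2 * cos (2 * \<nu>))"
  define S where "S = (\<lambda>\<nu>. - (a1 * sin \<nu> + a2 * sin (2 * \<nu>)))"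
  define \<epsilon> where "\<epsilon> t w = sqrt 2 * (C (w 0) * cos (w 0 * of_int t + w 1) + S (w 0) * sin (w 0 * of_int t + w 1))"
    for t :: int and w :: "int \<Rightarrow> real"
  note wave_Z = random_phase_wave[OF Z_def, of 1, folded M_def, simplified]
  have bound: "\<bar>C \<nu>\<bar> \<le> 1 + \<bar>a1\<bar> + \<bar>a2\<bar>" "\<bar>S \<nu>\<bar> \<le> 1 + \<bar>a1\<bar> + \<bar>a2\<bar>" for \<nu>
  proof -
    have "\<bar>a * cos x\<bar> \<le> \<bar>a\<bar>" "\<bar>a * sin x\<bar> \<le> \<bar>a\<bar>" for a x :: real
      by (simp_all add: abs_mult mult_left_le)
    from this(1)[of a1 \<nu>] this(1)[of a2 "2 * \<nu>"] this(2)[of a1 \<nu>] this(2)[of a2 "2 * \<nu>"]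
    show "\<bar>C \<nu>\<bar> \<le> 1 + \<bar>a1\<bar> + \<bar>a2\<bar>" "\<bar>S \<nu>\<bar> \<le> 1 + \<bar>a1\<bar> + \<bar>a2\<bar>"
      unfolding C_def S_def by linarith+
  qed
  have "continuous_on UNIV C" "continuous_on UNIV S"
    unfolding C_def S_def by (intro continuous_intros)+
  note wave_\<epsilon> = random_phase_wave[OF \<epsilon>_def this bound, folded M_def]
  have cov_\<epsilon>: "cov M (\<epsilon> s) (\<epsilon> t) = (if s = t then 2 * pi * c else 0)" for s t
  proof -
    have "f \<nu> * ((C \<nu>)\<^sup>2 + (S \<nu>)\<^sup>2) = c" if "\<nu> \<in> {-pi..pi}" for \<nu>
      using ar[OF that] unfolding C_def S_def power2_minus .
    then have "cov M (\<epsilon> s) (\<epsilon> t) = integral {-pi..pi} (\<lambda>\<nu>. c * cos (of_int (s - t) * \<nu>))"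
      unfolding wave_\<epsilon>(2) by (intro integral_cong) (simp only: mult.assoc[symmetric])
    also have "\<dots> = (if s = t then 2 * pi * c else 0)"
      using integral_cos_int[of "s - t"] by (simp del: of_int_diff)
    finally show ?thesis .
  qed
  have "white_noise M \<epsilon>"
    unfolding white_noise_def using wave_\<epsilon>(1,3) c by (simp add: cov_\<epsilon>)
  moreover have "Z t w = a1 * Z (t - 1) w + a2 * Z (t - 2) w + \<epsilon> t w" for t w
  proof -
    have "w 0 * of_int (t - 1) + w 1 = (w 0 * of_int t + w 1) - w 0"
      "w 0 * of_int (t - 2) + w 1 = (w 0 * of_int t + w 1) - 2 * w 0"
      by (simp_all add: algebra_simps)
    then show ?thesis
      unfolding Z_def \<epsilon>_def C_def S_def by (simp only: cos_diff) (simp add: algebra_simps)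
  qed
  ultimately have "stationary_AR2 M Z"
    unfolding stationary_AR2_def using wave_Z(3) by blast
  moreover have "normalized_spectral_density M Z f"
    unfolding normalized_spectral_density_def
    using f fourier_coeff_even[OF cont] wave_Z(2) by (simp add: F_all_def mult.commute)
  ultimately show ?thesis
    using f cont by (auto simp: F_AR2_def M_def)
qed

end


text \<open>A difference of cosines is a product of two sines, and
  \<open>\<bar>sin (h t)\<bar>\<close> is at most \<open>\<bar>h\<bar> \<bar>sin t\<bar>\<close>.
  Hence the mean of \<open>\<bar>cos \<nu> - cos \<omega>\<bar>\<close> alone controls all Fourier
  coefficients of a spike.\<close>

lemma cos_int_diff_le:
  fixes x y :: real and h :: int
  shows "\<bar>cos (of_int h * x) - cos (of_int h * y)\<bar> \<le> (of_int h)\<^sup>2 * \<bar>cos x - cos y\<bar>"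
proof -
  have sin_nat: "\<bar>sin (real n * t)\<bar> \<le> real n * \<bar>sin t\<bar>" for n and t :: real
  proof (induction n)
    case (Suc n)
    have "\<bar>sin (real (Suc n) * t)\<bar> = \<bar>sin (real n * t) * cos t + cos (real n * t) * sin t\<bar>"
      by (simp add: algebra_simps sin_add)
    also have "\<dots> \<le> \<bar>sin (real n * t)\<bar> * \<bar>cos t\<bar> + \<bar>cos (real n * t)\<bar> * \<bar>sin t\<bar>"
      by (metis abs_mult abs_triangle_ineq)
    also have "\<dots> \<le> \<bar>sin (real n * t)\<bar> * 1 + 1 * \<bar>sin t\<bar>"
      by (intro add_mono mult_mono) auto
    also have "\<dots> \<le> real (Suc n) * \<bar>sin t\<bar>"
      using Suc by (simp add: algebra_simps)
    finally show ?case .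
  qed simp
  have sin_int: "\<bar>sin (of_int h * t)\<bar> \<le> \<bar>of_int h\<bar> * \<bar>sin t\<bar>" for t :: real
  proof (cases "0 \<le> h")
    case True
    then show ?thesis
      using sin_nat[of "nat h" t] by simp
  next
    case False
    then show ?thesis
      using sin_nat[of "nat (- h)" t] by simp
  qed
  have "\<bar>cos (of_int h * x) - cos (of_int h * y)\<bar>
      = 2 * (\<bar>sin (of_int h * ((x + y) / 2))\<bar> * \<bar>sin (of_int h * ((y - x) / 2))\<bar>)"
    by (simp add: cos_diff_cos abs_mult algebra_simps add_divide_distrib diff_divide_distrib)
  also have "\<dots> \<le> 2 * ((\<bar>of_int h\<bar> * \<bar>sin ((x + y) / 2)\<bar>) * (\<bar>of_int h\<bar> * \<bar>sin ((y - x) / 2)\<bar>))"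
    by (intro mult_left_mono mult_mono sin_int) auto
  also have "\<dots> = (of_int h)\<^sup>2 * \<bar>cos x - cos y\<bar>"
    by (simp add: cos_diff_cos abs_mult power2_eq_square)
  finally show ?thesis .
qed

text \<open>
  With \<open>a\<^sub>2 = -b\<close> and \<open>a\<^sub>1 = 4b cos \<omega> / (1 + b)\<close> the squared modulus of \<open>1 - a\<^sub>1 e\<^sup>-\<^sup>i\<^sup>\<nu> - a\<^sub>2 e\<^sup>-\<^sup>2\<^sup>i\<^sup>\<nu>\<close> is
  \<open>4b(cos \<nu> - cos \<omega>)\<^sup>2 + e\<close> with \<open>0 < e \<le> (1 - b)\<^sup>2\<close>, so the mass concentrates at \<open>\<plusminus>\<omega>\<close> as \<open>b \<rightarrow> 1\<close>.
\<close>
lemma AR2_spike: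
  fixes \<omega> \<delta> :: real
  assumes \<omega>: "0 < \<omega>" "\<omega> < pi" and \<delta>: "0 < \<delta>"
  obtains f where "f \<in> F_AR2"
    and "\<And>h. \<bar>integral {-pi..pi} (\<lambda>\<nu>. cos (of_int h * \<nu>) * f \<nu>) - cos (of_int h * \<omega>)\<bar> \<le> (of_int h)\<^sup>2 * \<delta>"
proof -
  define \<tau> where "\<tau> = \<delta> / 2"
  have \<tau>: "0 < \<tau>" using \<delta> by (simp add: \<tau>_def)
  \<comment> \<open>The first bound keeps \<open>b\<close> at least 1/2. The second keeps the
    interval from \<open>\<omega> - sqrt e\<close> to \<open>\<omega>\<close> inside the range of
    integration, because \<open>sqrt e\<close> is at most \<open>s\<close>. The third makes the
    final error term \<open>5 * pi * s / \<tau>\<close> at most \<open>\<tau>\<close>.\<close>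
  define s where "s = min (1 / 2) (min \<omega> (\<tau>\<^sup>2 / (5 * pi)))"
  have s: "0 < s" "s \<le> 1 / 2" "s \<le> \<omega>" "5 * pi * s \<le> \<tau>\<^sup>2"
  proof -
    have "s \<le> \<tau>\<^sup>2 / (5 * pi)" by (simp add: s_def)
    then show "5 * pi * s \<le> \<tau>\<^sup>2" by (simp add: field_simps)
  qed (use \<omega> \<tau> in \<open>auto simp: s_def\<close>)
  define b where "b = 1 - s"
  have b: "1 / 2 \<le> b" "b < 1" using s by (auto simp: b_def)
  define C where "C = cos \<omega>"
  have "\<bar>C\<bar> < 1"
    using \<omega> cos_monotone_0_pi[of 0 \<omega>] cos_monotone_0_pi[of \<omega> pi] by (simp add: C_def abs_less_iff)
  then have C2: "C\<^sup>2 < 1" by (simp add: abs_square_less_1)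
  \<comment> \<open>The remainder after completing the square in \<open>cos \<nu>\<close>. It is
    positive because \<open>4 * b\<close> is at most \<open>(1 + b)^2\<close> and
    \<open>C^2 < 1\<close>.\<close>
  define e where "e = s\<^sup>2 * (1 - 4 * b * C\<^sup>2 / (1 + b)\<^sup>2)"
  have "4 * b \<le> (1 + b)\<^sup>2"
    using zero_le_power2[of "1 - b"] by (simp add: power2_eq_square algebra_simps)
  then have "4 * b * C\<^sup>2 \<le> (1 + b)\<^sup>2 * C\<^sup>2" by (rule mult_right_mono) simp
  also have "\<dots> < (1 + b)\<^sup>2 * 1"
    using C2 b by (intro mult_strict_left_mono) auto
  finally have "4 * b * C\<^sup>2 / (1 + b)\<^sup>2 < 1"
    using b by (simp add: divide_less_eq)
  moreover have "0 \<le> 4 * b * C\<^sup>2 / (1 + b)\<^sup>2" using b by simp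
  ultimately have e: "0 < e" "e \<le> s\<^sup>2"
    using s(1) unfolding e_def by (auto intro!: mult_left_le)
  define D where "D \<nu> = 4 * b * (cos \<nu> - C)\<^sup>2 + e" for \<nu>
  have D: "e \<le> D \<nu>" "4 * b * (cos \<nu> - C)\<^sup>2 \<le> D \<nu>" "0 < D \<nu>" for \<nu>
    using e b by (auto simp: D_def add_nonneg_pos)
  define g where "g \<nu> = 1 / D \<nu>" for \<nu>
  have g0: "0 < g \<nu>" for \<nu> using D by (simp add: g_def)
  have contg: "continuous_on A g" for A
    unfolding g_def D_def using D(3) unfolding D_def by (intro continuous_intros) (auto simp: less_imp_neq[symmetric])
  note integrable = integrable_continuous_real
  define I where "I = integral {-pi..pi} g"
  \<comment> \<open>On an interval of length \<open>sqrt e\<close> ending at \<omega> the cosine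
    differs from \<open>C\<close> by at most \<open>sqrt e\<close>, so \<open>D\<close> is at most
    \<open>4 * e + e\<close> there.\<close>
  have I: "1 / (5 * sqrt e) \<le> I"
  proof -
    have se: "sqrt e \<le> s" "0 < sqrt e" using e s(1) by (auto simp: real_le_lsqrt)
    have "1 / (5 * e) \<le> g \<nu>" if "\<nu> \<in> {\<omega> - sqrt e..\<omega>}" for \<nu>
    proof -
      have "\<bar>cos \<nu> - cos \<omega>\<bar> \<le> \<bar>\<nu> - \<omega>\<bar>"
      proof -
        have "\<bar>cos \<nu> - cos \<omega>\<bar> = 2 * (\<bar>sin ((\<nu> + \<omega>) / 2)\<bar> * \<bar>sin ((\<omega> - \<nu>) / 2)\<bar>)"
          by (simp add: cos_diff_cos abs_mult)
        also have "\<dots> \<le> 2 * (1 * \<bar>(\<omega> - \<nu>) / 2\<bar>)"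
          by (intro mult_left_mono mult_mono abs_sin_x_le_abs_x) auto
        finally show ?thesis by simp
      qed
      then have "\<bar>cos \<nu> - C\<bar> \<le> sqrt e"
        using that by (auto simp: C_def)
      then have "(cos \<nu> - C)\<^sup>2 \<le> (sqrt e)\<^sup>2"
        by (metis abs_ge_zero power2_abs power_mono)
      then have "(cos \<nu> - C)\<^sup>2 \<le> e" using e by simp
      then have "4 * b * (cos \<nu> - C)\<^sup>2 \<le> 4 * 1 * e"
        using b by (intro mult_mono) auto
      then have "D \<nu> \<le> 5 * e" by (simp add: D_def)
      then show ?thesis using D(3)[of \<nu>] unfolding g_def by (intro divide_left_mono) auto
    qed
    then have "integral {\<omega> - sqrt e..\<omega>} (\<lambda>_. 1 / (5 * e)) \<le> integral {\<omega> - sqrt e..\<omega>} g"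
      by (intro integral_le integrable contg) auto
    also have "\<dots> \<le> I"
      unfolding I_def using se s \<omega>
      by (intro integral_subset_le integrable contg) (auto intro: less_imp_le[OF g0])
    finally have "sqrt e / (5 * e) \<le> I" using e by simp
    moreover have "sqrt e / (5 * e) = 1 / (5 * sqrt e)"
      using e by (simp add: field_simps flip: power2_eq_square)
    ultimately show ?thesis by simp
  qed
  have I0: "0 < I"
    using less_le_trans[OF _ I] e by simp
  define f where "f = restrict (\<lambda>\<nu>. g \<nu> / I) {-pi..pi}"
  have contf: "continuous_on {-pi..pi} f"
    by (rule continuous_on_eq[of _ "\<lambda>\<nu>. g \<nu> / I"])
       (use I0 in \<open>auto simp: f_def intro!: continuous_intros contg\<close>)
  have intf: "integral {-pi..pi} f = 1"
  proof -
    have "integral {-pi..pi} f = integral {-pi..pi} (\<lambda>\<nu>. g \<nu> / I)"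
      by (rule integral_cong) (simp add: f_def)
    then show ?thesis using I0 by (simp add: I_def)
  qed
  have f_all: "f \<in> F_all"
    unfolding F_all_def
  proof (intro CollectI conjI ballI)
    show "f \<in> {-pi..pi} \<rightarrow>\<^sub>E {0..}"
      using I0 g0 by (auto simp: f_def intro!: divide_nonneg_pos less_imp_le[OF g0])
    show "f (- \<nu>) = f \<nu>" if "\<nu> \<in> {-pi..pi}" for \<nu>
      using that by (simp add: f_def g_def D_def)
    show "f absolutely_integrable_on {-pi..pi}"
      by (rule absolutely_integrable_continuous_real[OF contf])
  qed (rule intf)
  have "f \<in> F_AR2"
  proof (rule AR2_spectral_density[OF f_all contf, of "1 / I" "4 * b * C / (1 + b)" "- b"])
    fix \<nu> assume \<nu>: "\<nu> \<in> {-pi..pi}"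
    have "(1 - 4 * b * C / (1 + b) * cos \<nu> - - b * cos (2 * \<nu>))\<^sup>2
        + (4 * b * C / (1 + b) * sin \<nu> + - b * sin (2 * \<nu>))\<^sup>2 = D \<nu>"
    proof -
      \<comment> \<open>The first autoregressive coefficient satisfies
        \<open>a * (1 + b) = 4 * b * C\<close>, which is what centres the square at
        \<open>C\<close>.\<close>
      define a c where "a = 4 * b * C / (1 + b)" and "c = cos \<nu>"
      have a: "a * (1 + b) = 4 * b * C" using b by (simp add: a_def)
      have s2: "(sin \<nu>)\<^sup>2 = 1 - c\<^sup>2" by (simp add: c_def sin_squared_eq)
      have "(1 - a * c - - b * cos (2 * \<nu>))\<^sup>2 + (a * sin \<nu> + - b * sin (2 * \<nu>))\<^sup>2
          = (1 - a * c + b * (2 * c\<^sup>2 - 1))\<^sup>2 + (a - 2 * b * c)\<^sup>2 * (sin \<nu>)\<^sup>2"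
        unfolding cos_double_cos sin_double c_def[symmetric] by algebra
      also have "\<dots> = 4 * b * c\<^sup>2 - 2 * (a * (1 + b)) * c + (1 - b)\<^sup>2 + a\<^sup>2"
        unfolding s2 by algebra
      also have "\<dots> = 4 * b * (c - C)\<^sup>2 + ((1 - b)\<^sup>2 + a\<^sup>2 - 4 * b * C\<^sup>2)"
        unfolding a by algebra
      also have "(1 - b)\<^sup>2 + a\<^sup>2 - 4 * b * C\<^sup>2 = e"
      proof -
        have "e * (1 + b)\<^sup>2 = (1 - b)\<^sup>2 * ((1 + b)\<^sup>2 - 4 * b * C\<^sup>2)"
          using b by (simp add: e_def b_def field_simps)
        then have "((1 - b)\<^sup>2 + a\<^sup>2 - 4 * b * C\<^sup>2) * (1 + b)\<^sup>2 = e * (1 + b)\<^sup>2"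
          using a by algebra
        then show ?thesis using b by simp
      qed
      finally show ?thesis by (simp add: D_def a_def c_def)
    qed
    then show "f \<nu> * ((1 - 4 * b * C / (1 + b) * cos \<nu> - - b * cos (2 * \<nu>))\<^sup>2
        + (4 * b * C / (1 + b) * sin \<nu> + - b * sin (2 * \<nu>))\<^sup>2) = 1 / I"
      using \<nu> D(3)[of \<nu>] by (simp add: f_def g_def)
  qed (use I0 in simp)
  moreover have "\<bar>integral {-pi..pi} (\<lambda>\<nu>. cos (of_int h * \<nu>) * f \<nu>) - cos (of_int h * \<omega>)\<bar> \<le> (of_int h)\<^sup>2 * \<delta>"
    for h :: int
  proof -
    have f0: "0 \<le> f \<nu>" if "\<nu> \<in> {-pi..pi}" for \<nu>
      using f_all that by (auto simp: F_all_def PiE_iff)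
    have cf: "(\<lambda>\<nu>. cos (of_int h * \<nu>) * f \<nu>) integrable_on {-pi..pi}"
      by (intro integrable continuous_intros contf)
    \<comment> \<open>From \<open>d \<le> \<tau> + d^2 / \<tau>\<close>: in the second term
      \<open>d^2\<close> cancels the peak of the density, since
      \<open>4 * b * d^2 \<le> D \<nu>\<close>. What remains is a constant of order
      \<open>1 / I\<close>, and \<open>1 / I\<close> is at most \<open>5 * s\<close>.\<close>
    have dom: "\<bar>cos \<nu> - C\<bar> * f \<nu> \<le> \<tau> * f \<nu> + 1 / (4 * b * \<tau> * I)" if "\<nu> \<in> {-pi..pi}" for \<nu>
    proof -
      define d where "d = \<bar>cos \<nu> - C\<bar>"
      have "2 * \<tau> * d \<le> \<tau>\<^sup>2 + d\<^sup>2"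
        using sum_squares_bound[of \<tau> d] by simp
      moreover have "0 \<le> \<tau> * d" using \<tau> by (simp add: d_def)
      ultimately have "d \<le> \<tau> + d\<^sup>2 / \<tau>"
        using \<tau> by (simp add: field_simps power2_eq_square)
      then have "d * f \<nu> \<le> (\<tau> + d\<^sup>2 / \<tau>) * f \<nu>"
        using f0[OF that] by (rule mult_right_mono)
      also have "\<dots> = \<tau> * f \<nu> + (4 * b * d\<^sup>2 / D \<nu>) / (4 * b * \<tau> * I)"
        using that b \<tau> D(3)[of \<nu>] I0 by (simp add: f_def g_def field_simps)
      also have "\<dots> \<le> \<tau> * f \<nu> + 1 / (4 * b * \<tau> * I)"
        using D(2,3)[of \<nu>] b \<tau> I0 by (intro add_left_mono divide_right_mono) (auto simp: d_def divide_le_eq)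
      finally show ?thesis by (simp add: d_def)
    qed
    have "integral {-pi..pi} (\<lambda>\<nu>. cos (of_int h * \<nu>) * f \<nu>) - cos (of_int h * \<omega>)
        = integral {-pi..pi} (\<lambda>\<nu>. cos (of_int h * \<nu>) * f \<nu>) - cos (of_int h * \<omega>) * integral {-pi..pi} f"
      by (simp add: intf)
    also have "\<dots> = integral {-pi..pi} (\<lambda>\<nu>. cos (of_int h * \<nu>) * f \<nu> - cos (of_int h * \<omega>) * f \<nu>)"
      by (subst Henstock_Kurzweil_Integration.integral_diff[OF cf])
         (auto intro!: integrable continuous_intros contf)
    also have "\<bar>\<dots>\<bar> \<le> integral {-pi..pi} (\<lambda>\<nu>. (of_int h)\<^sup>2 * (\<tau> * f \<nu> + 1 / (4 * b * \<tau> * I)))"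
      unfolding real_norm_def[symmetric]
    proof (rule integral_norm_bound_integral)
      fix \<nu> assume \<nu>: "\<nu> \<in> {-pi..pi}"
      have "norm (cos (of_int h * \<nu>) * f \<nu> - cos (of_int h * \<omega>) * f \<nu>)
          = \<bar>cos (of_int h * \<nu>) - cos (of_int h * \<omega>)\<bar> * f \<nu>"
        using f0[OF \<nu>] by (simp add: left_diff_distrib[symmetric] abs_mult)
      also have "\<dots> \<le> (of_int h)\<^sup>2 * \<bar>cos \<nu> - C\<bar> * f \<nu>"
        using f0[OF \<nu>] cos_int_diff_le[of h \<nu> \<omega>] by (intro mult_right_mono) (auto simp: C_def)
      also have "\<dots> \<le> (of_int h)\<^sup>2 * (\<tau> * f \<nu> + 1 / (4 * b * \<tau> * I))"
        using mult_left_mono[OF dom[OF \<nu>], of "(of_int h)\<^sup>2"] by (simp add: mult.assoc)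
      finally show "norm (cos (of_int h * \<nu>) * f \<nu> - cos (of_int h * \<omega>) * f \<nu>)
          \<le> (of_int h)\<^sup>2 * (\<tau> * f \<nu> + 1 / (4 * b * \<tau> * I))" .
    qed (intro integrable continuous_intros contf)+
    also have "\<dots> = (of_int h)\<^sup>2 * (\<tau> + 2 * pi / (4 * b * \<tau> * I))"
    proof -
      have "integral {-pi..pi} (\<lambda>\<nu>. \<tau> * f \<nu> + 1 / (4 * b * \<tau> * I)) = \<tau> + 2 * pi / (4 * b * \<tau> * I)"
        by (subst Henstock_Kurzweil_Integration.integral_add)
           (auto intro!: integrable continuous_intros contf simp: intf)
      then show ?thesis by simp
    qed
    also have "\<dots> \<le> (of_int h)\<^sup>2 * \<delta>"
    proof (rule mult_left_mono)
      have "1 / I \<le> 5 * sqrt e"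
        using I I0 e by (simp add: field_simps)
      also have "sqrt e \<le> s" using e s(1) by (simp add: real_le_lsqrt)
      finally have "1 / I \<le> 5 * s" by simp
      then have "2 * pi / (4 * b * \<tau>) * (1 / I) \<le> 2 * pi / (4 * (1 / 2) * \<tau>) * (5 * s)"
        using b \<tau> s I0 by (intro mult_mono divide_left_mono) auto
      also have "\<dots> = 5 * pi * s / \<tau>" by simp
      also have "\<dots> \<le> \<tau>"
        using s(4) \<tau> by (simp add: divide_le_eq power2_eq_square)
      finally have "\<tau> + 2 * pi / (4 * b * \<tau> * I) \<le> 2 * \<tau>"
        by (simp add: ac_simps)
      then show "\<tau> + 2 * pi / (4 * b * \<tau> * I) \<le> \<delta>"
        by (simp only: \<tau>_def)
    qed simp
    finally show ?thesis .
  qed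
  ultimately show thesis by (rule that)
qed

section \<open>Covariance matrices of a spike mixed with white noise\<close>

lemma pos_inj: "pos i = pos j \<longleftrightarrow> i = j" for i j :: "'a::{finite,linorder}"
proof -
  have "pos i < pos j" if "i < j" for i j :: 'a
    unfolding pos_def using that by (intro psubset_card_mono) (auto simp: less_le_not_le set_eq_iff intro: order_trans)
  then show ?thesis
    by (metis less_irrefl linorder_cases)
qed

lemma pos_bounds: "1 \<le> pos i" "pos i \<le> CARD('a)" for i :: "'a::{finite,linorder}"
proof -
  have "card {i} \<le> pos i"
    unfolding pos_def by (intro card_mono) auto
  then show "1 \<le> pos i" by simp
  show "pos i \<le> CARD('a)"
    unfolding pos_def by (intro card_mono) auto
qed

lemma pos_surj:
  assumes "1 \<le> m" "m \<le> CARD('a::{finite,linorder})"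
  obtains i :: "'a::{finite,linorder}" where "pos i = m"
proof -
  have "pos ` (UNIV :: 'a set) = {1..CARD('a)}"
    by (intro card_subset_eq) (auto simp: card_image inj_on_def pos_inj pos_bounds[unfolded One_nat_def])
  with assms that show thesis
    by (metis atLeastAtMost_iff imageE)
qed

text \<open>The constant \<open>c / (2 * pi)\<close> contributes at lag zero only, since the other
  cosines integrate to zero; by injectivity of \<open>pos\<close>, lag zero means the
  diagonal.\<close>

lemma Sigma_mat_F_AR2_ext:
  assumes f: "f \<in> F_AR2" and c: "0 \<le> c" "c \<le> 1"
  obtains f' where "f' \<in> F_AR2_ext"
    and "\<And>j l. (Sigma_mat f' :: ((real,'n::{finite,linorder}) vec,'n) vec) $ j $ l
      = (1 - c) * integral {-pi..pi} (\<lambda>\<nu>. cos (of_int (int (pos j) - int (pos l)) * \<nu>) * f \<nu>)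
        + (if j = l then c else 0)"
proof
  define f' where "f' = restrict (\<lambda>\<nu>. (1 - c) * f \<nu> + c / (2 * pi)) {-pi..pi}"
  show "f' \<in> F_AR2_ext"
    unfolding F_AR2_ext_def f'_def using f c by (intro CollectI exI[of _ f] exI[of _ "1 - c"] exI[of _ c]) auto
  have cont: "continuous_on {-pi..pi} f" and even: "\<And>\<nu>. \<nu> \<in> {-pi..pi} \<Longrightarrow> f (- \<nu>) = f \<nu>"
    using f by (auto simp: F_AR2_def F_all_def)
  have cont': "continuous_on {-pi..pi} f'"
    by (rule continuous_on_eq[of _ "\<lambda>\<nu>. (1 - c) * f \<nu> + c / (2 * pi)"])
       (auto simp: f'_def intro!: continuous_intros cont)
  have even': "f' (- \<nu>) = f' \<nu>" if "\<nu> \<in> {-pi..pi}" for \<nu>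
    using that by (simp add: f'_def even)
  fix j l :: 'n
  let ?h = "int (pos j) - int (pos l)"
  have "integral {-pi..pi} (\<lambda>\<nu>. cos (of_int ?h * \<nu>) * f' \<nu>)
      = integral {-pi..pi} (\<lambda>\<nu>. (1 - c) * (cos (of_int ?h * \<nu>) * f \<nu>) + c / (2 * pi) * cos (of_int ?h * \<nu>))"
    by (intro integral_cong) (simp add: f'_def algebra_simps)
  also have "\<dots> = (1 - c) * integral {-pi..pi} (\<lambda>\<nu>. cos (of_int ?h * \<nu>) * f \<nu>)
      + c / (2 * pi) * integral {-pi..pi} (\<lambda>\<nu>. cos (of_int ?h * \<nu>))"
    by (subst Henstock_Kurzweil_Integration.integral_add)
       (auto intro!: integrable_continuous_real continuous_intros cont)
  also have "c / (2 * pi) * integral {-pi..pi} (\<lambda>\<nu>. cos (of_int ?h * \<nu>)) = (if j = l then c else 0)"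
    by (simp only: integral_cos_int) (simp add: pos_inj)
  finally show "(Sigma_mat f' :: ((real,'n) vec,'n) vec) $ j $ l
      = (1 - c) * integral {-pi..pi} (\<lambda>\<nu>. cos (of_int ?h * \<nu>) * f \<nu>) + (if j = l then c else 0)"
    by (simp only: Sigma_mat_def vec_lambda_beta fourier_coeff_even[OF cont' even'] Re_complex_of_real)
qed

lemma norm_matrix_le_sum: "norm (A :: real^'m^'n) \<le> (\<Sum>i\<in>UNIV. \<Sum>j\<in>UNIV. \<bar>A $ i $ j\<bar>)"
proof -
  have "norm A \<le> (\<Sum>i\<in>UNIV. norm (A $ i))"
    unfolding norm_vec_def[of A] by (rule L2_set_le_sum) simp
  also have "\<dots> \<le> (\<Sum>i\<in>UNIV. \<Sum>j\<in>UNIV. \<bar>A $ i $ j\<bar>)"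
    by (intro sum_mono norm_le_l1_cart)
  finally show ?thesis .
qed

lemma trendE_mult_transpose:
  "(trendE 0 \<omega> ** transpose (trendE 0 \<omega>)) $ j $ l
    = cos (of_int (int (pos j) - int (pos l)) * \<omega>)" for j l :: "'n::{finite,linorder}"
  by (simp add: matrix_matrix_mult_def transpose_def trendE_def sum_2 left_diff_distrib cos_diff)

text \<open>The matrix \<open>E E'\<close> has the entries \<open>cos ((j - l) \<omega>)\<close>,
  which are the limits of the Fourier coefficients of a spike at \<omega>. The accuracy
  \<open>\<delta>\<close> may be prescribed after the weight \<open>c\<close>, so it can be small
  compared with \<open>c\<close>.\<close>

lemma F_AR2_ext_spike:
  fixes \<omega> \<delta> c :: real and E :: "real^2^'n::{finite,linorder}"
  assumes \<omega>: "0 < \<omega>" "\<omega> < pi" and c: "0 \<le> c" "c \<le> 1" and \<delta>: "0 < \<delta>"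
    and E_def: "E = trendE 0 \<omega>"
  obtains f where "f \<in> F_AR2_ext"
    and "transpose (Sigma_mat f) = (Sigma_mat f :: ((real,'n::{finite,linorder}) vec,'n) vec)"
    and "norm (Sigma_mat f - ((1 - c) *\<^sub>R (E ** transpose E) + c *\<^sub>R mat 1)) \<le> \<delta>"
proof -
  define n where "n = real CARD('n)"
  have n: "0 < n" by (simp add: n_def)
  \<comment> \<open>Squared lags are at most \<open>n^2\<close>, and there are \<open>n^2\<close>
    entries to sum, whence the fourth power.\<close>
  from n \<delta> have "0 < \<delta> / n ^ 4" by simp
  from AR2_spike[OF \<omega> this] obtain f where f: "f \<in> F_AR2"
    and spike: "\<And>h. \<bar>integral {-pi..pi} (\<lambda>\<nu>. cos (of_int h * \<nu>) * f \<nu>) - cos (of_int h * \<omega>)\<bar>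
      \<le> (of_int h)\<^sup>2 * (\<delta> / n ^ 4)"
    by blast
  obtain f' where f': "f' \<in> F_AR2_ext"
    and Sig: "\<And>j l. (Sigma_mat f' :: ((real,'n) vec,'n) vec) $ j $ l
      = (1 - c) * integral {-pi..pi} (\<lambda>\<nu>. cos (of_int (int (pos j) - int (pos l)) * \<nu>) * f \<nu>)
        + (if j = l then c else 0)"
    using Sigma_mat_F_AR2_ext[OF f c] by blast
  have sym: "transpose (Sigma_mat f') = (Sigma_mat f' :: ((real,'n) vec,'n) vec)"
  proof -
    have "cos (of_int (int (pos l) - int (pos j)) * \<nu>) = cos (of_int (int (pos j) - int (pos l)) * \<nu>)"
      for j l :: 'n and \<nu> :: real
      using cos_minus[of "of_int (int (pos j) - int (pos l)) * \<nu>"] by (simp add: algebra_simps)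
    then have "(Sigma_mat f' :: ((real,'n) vec,'n) vec) $ l $ j = (Sigma_mat f' :: ((real,'n) vec,'n) vec) $ j $ l"
      for j l
      by (simp only: Sig eq_commute[of l j])
    then show ?thesis
      by (simp add: vec_eq_iff transpose_def)
  qed
  let ?D = "Sigma_mat f' - ((1 - c) *\<^sub>R (E ** transpose E) + c *\<^sub>R mat 1)"
  have "\<bar>?D $ j $ l\<bar> \<le> \<delta> / n\<^sup>2" for j l
  proof -
    let ?h = "int (pos j) - int (pos l)"
    have "?D $ j $ l = (1 - c) * (integral {-pi..pi} (\<lambda>\<nu>. cos (of_int ?h * \<nu>) * f \<nu>) - cos (of_int ?h * \<omega>))"
      unfolding E_def by (simp add: Sig trendE_mult_transpose mat_def right_diff_distrib del: of_int_diff)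
    then have "\<bar>?D $ j $ l\<bar> = (1 - c) * \<bar>integral {-pi..pi} (\<lambda>\<nu>. cos (of_int ?h * \<nu>) * f \<nu>) - cos (of_int ?h * \<omega>)\<bar>"
      using c by (simp add: abs_mult)
    also have "\<dots> \<le> 1 * ((of_int ?h)\<^sup>2 * (\<delta> / n ^ 4))"
      using c \<delta> n by (intro mult_mono spike) auto
    also have "(of_int ?h :: real)\<^sup>2 \<le> n\<^sup>2"
    proof -
      have "\<bar>?h\<bar> \<le> int CARD('n)"
        using pos_bounds[of j] pos_bounds[of l] by linarith
      then have "\<bar>of_int ?h :: real\<bar> \<le> n"
        unfolding n_def by (metis of_int_abs of_int_le_iff of_int_of_nat_eq)
      then show ?thesis
        using n by (simp add: abs_le_square_iff[symmetric])
    qed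
    then have "1 * ((of_int ?h)\<^sup>2 * (\<delta> / n ^ 4)) \<le> 1 * (n\<^sup>2 * (\<delta> / n ^ 4))"
      using \<delta> n by (intro mult_left_mono mult_right_mono) auto
    also have "\<dots> = \<delta> / n\<^sup>2"
      using n by (simp add: field_simps power2_eq_square power4_eq_xxxx)
    finally show ?thesis .
  qed
  then have "(\<Sum>j\<in>UNIV. \<Sum>l\<in>UNIV. \<bar>?D $ j $ l\<bar>) \<le> (\<Sum>j::'n\<in>UNIV. \<Sum>l::'n\<in>UNIV. \<delta> / n\<^sup>2)"
    by (intro sum_mono)
  also have "\<dots> = \<delta>"
    using n by (simp add: n_def power2_eq_square)
  finally have "norm ?D \<le> \<delta>"
    using norm_matrix_le_sum[of ?D] by linarith
  with f' sym show thesis by (rule that)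
qed


section \<open>Factorization of covariance matrices\<close>

lemma norm_matrix_vector_mult: "norm (A *v x) \<le> norm A * norm x" for A :: "real^'m^'n"
proof -
  have "norm (A *v x) \<le> L2_set (\<lambda>i. norm (A $ i) * norm x) UNIV"
    unfolding norm_vec_def[of "A *v x"]
    by (intro L2_set_mono) (auto simp: matrix_vector_mul_component Cauchy_Schwarz_ineq2)
  also have "\<dots> = norm A * norm x"
    by (simp add: norm_vec_def[of A] L2_set_left_distrib)
  finally show ?thesis .
qed

text \<open>The norm of the nested vector type is the Frobenius norm, a sum over all
  entries.\<close>

lemma norm_transpose: "norm (transpose A) = norm (A :: real^'m^'n)"
proof -
  have "norm (B :: real^'b^'a) = sqrt (\<Sum>i\<in>UNIV. \<Sum>j\<in>UNIV. (B $ i $ j)\<^sup>2)" for B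
    by (simp add: norm_vec_def L2_set_def sum_nonneg)
  then show ?thesis
    using sum.swap[of "\<lambda>i j. (A $ i $ j)\<^sup>2" UNIV UNIV] by (simp add: transpose_def norm_vec_def L2_set_def sum_nonneg)
qed

lemma norm_matrix_mult: "norm (A ** B) \<le> norm A * norm B" for A :: "real^'m^'n" and B :: "real^'k^'m"
proof -
  have row: "(A ** B) $ i = transpose B *v (A $ i)" for i
    by (simp add: vec_eq_iff matrix_matrix_mult_def matrix_vector_mult_def transpose_def mult.commute)
  have "norm (A ** B) \<le> L2_set (\<lambda>i. norm (A $ i) * norm B) UNIV"
    unfolding norm_vec_def[of "A ** B"]
    using norm_matrix_vector_mult[of "transpose B"]
    by (intro L2_set_mono) (simp_all add: row norm_transpose mult.commute[of _ "norm B"] del: transpose_matrix_vector)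
  also have "\<dots> = norm A * norm B"
    by (simp add: norm_vec_def[of A] L2_set_left_distrib)
  finally show ?thesis .
qed

lemma bounded_bilinear_matrix_mult: "bounded_bilinear ((**) :: real^'m^'n \<Rightarrow> real^'k^'m \<Rightarrow> real^'k^'n)"
proof (rule bounded_bilinear.intro)
  show "\<exists>K. \<forall>A B. norm ((A :: real^'m^'n) ** (B :: real^'k^'m)) \<le> norm A * norm B * K"
    by (rule exI[of _ 1]) (simp add: norm_matrix_mult)
qed (simp_all add: vec_eq_iff matrix_matrix_mult_def sum.distrib algebra_simps sum_distrib_left)

text \<open>A root \<open>I + Y\<close> of \<open>I + \<Delta>\<close> is a fixed point of \<open>Y \<mapsto> (\<Delta> - Y\<^sup>2) / 2\<close> (Brouwer).\<close>
lemma sqrt_near_identity: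
  fixes \<Delta> :: "real^'n^'n"
  assumes sym: "transpose \<Delta> = \<Delta>" and \<Delta>: "norm \<Delta> \<le> e" and e: "e \<le> 1"
  obtains Y where "transpose Y = Y" "norm Y \<le> e" "(mat 1 + Y) ** (mat 1 + Y) = mat 1 + \<Delta>"
proof -
  interpret M: bounded_bilinear "(**) :: real^'n^'n \<Rightarrow> real^'n^'n \<Rightarrow> real^'n^'n"
    by (rule bounded_bilinear_matrix_mult)
  have e0: "0 \<le> e" using \<Delta> norm_ge_zero order_trans by blast
  have tr: "linear (transpose :: real^'n^'n \<Rightarrow> real^'n^'n)"
    by (auto simp: linear_iff transpose_def vec_eq_iff)
  \<comment> \<open>Restricting to symmetric matrices yields a symmetric root. Written as the kernel
    of a linear map, the symmetric matrices are visibly closed and convex.\<close>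
  let ?S = "{Y :: real^'n^'n. transpose Y - Y = 0} \<inter> cball 0 e"
  let ?g = "\<lambda>Y :: real^'n^'n. (1 / 2) *\<^sub>R (\<Delta> - Y ** Y)"
  have "closed {Y :: real^'n^'n. transpose Y - Y = 0}"
    by (intro closed_Collect_eq continuous_intros linear_continuous_on linear_conv_bounded_linear[THEN iffD1] tr)
  then have "compact ?S"
    by (intro closed_Int_compact) auto
  moreover have "convex ?S"
  proof (intro convex_Int convex_cball)
    have "subspace {Y :: real^'n^'n. transpose Y - Y = 0}"
      using tr by (intro linear_subspace_kernel linear_compose_sub) (auto intro: bounded_linear.linear)
    then show "convex {Y :: real^'n^'n. transpose Y - Y = 0}"
      by (rule subspace_imp_convex)
  qed
  moreover have "0 \<in> ?S" using e0 by (simp add: transpose_def vec_eq_iff)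
  moreover have "continuous_on ?S ?g"
    by (intro continuous_intros M.continuous_on)
  moreover have "?g \<in> ?S \<rightarrow> ?S"
  proof
    fix Y assume Y: "Y \<in> ?S"
    then have "transpose (?g Y) = ?g Y"
      using linear_diff[OF tr] linear_scale[OF tr] sym by (simp add: matrix_transpose_mul)
    \<comment> \<open>Since \<open>e\<close> is at most 1, the square \<open>Y ** Y\<close> again
      has norm at most \<open>e\<close>, and the factor 1/2 halves the sum of the two
      bounds.\<close>
    moreover have "norm (?g Y) \<le> e"
    proof -
      have "norm (Y ** Y) \<le> e * e"
        using Y e0 by (intro order_trans[OF norm_matrix_mult] mult_mono) auto
      also have "\<dots> \<le> e" using e e0 by (simp add: mult_left_le)
      finally have "norm (\<Delta> - Y ** Y) \<le> e + e"
        using \<Delta> norm_triangle_ineq4[of \<Delta> "Y ** Y"] by linarith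
      then show ?thesis by simp
    qed
    ultimately show "?g Y \<in> ?S" by simp
  qed
  ultimately obtain Y where Y: "Y \<in> ?S" and fp: "?g Y = Y"
    using brouwer[of ?S ?g] by blast
  have "2 *\<^sub>R Y = \<Delta> - Y ** Y"
    using arg_cong[OF fp, of "\<lambda>Z. 2 *\<^sub>R Z"] by simp
  then have "(mat 1 + Y) ** (mat 1 + Y) = mat 1 + \<Delta>"
    by (simp add: M.add_left M.add_right scaleR_2 algebra_simps)
  with Y show thesis by (intro that) auto
qed


text \<open>A singular value decomposition by the intermediate value theorem. Turning an orthonormal
  frame of the plane by a right angle changes the sign of the inner product \<open>F\<close> of the
  images, so some frame has orthogonal images. By injectivity these are nonzero and can be
  normalized.\<close>

lemma singular_frame:
  fixes E :: "real^2^'n"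
  assumes inj: "inj ((*v) E)"
  obtains w1 w2 :: "real^2" and u1 u2 :: "real^'n" and l1 l2 :: real
  where "\<And>x. x = (w1 \<bullet> x) *\<^sub>R w1 + (w2 \<bullet> x) *\<^sub>R w2"
    and "w1 \<bullet> w1 = 1" "w2 \<bullet> w2 = 1" "w1 \<bullet> w2 = 0"
    and "u1 \<bullet> u1 = 1" "u2 \<bullet> u2 = 1" "u1 \<bullet> u2 = 0"
    and "0 < l1" "0 < l2" "E *v w1 = l1 *\<^sub>R u1" "E *v w2 = l2 *\<^sub>R u2"
proof -
  define w where "w t = (vector [cos t, sin t] :: real^2)" for t
  define w' where "w' t = (vector [- sin t, cos t] :: real^2)" for t
  have lin: "E *v w t = cos t *\<^sub>R column 1 E + sin t *\<^sub>R column 2 E"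
    "E *v w' t = - sin t *\<^sub>R column 1 E + cos t *\<^sub>R column 2 E" for t
    by (simp_all add: w_def w'_def vec_eq_iff matrix_vector_mult_def sum_2 column_def)
  define F where "F t = (E *v w t) \<bullet> (E *v w' t)" for t
  have cont: "continuous_on {0..pi / 2} F"
    unfolding F_def lin by (intro continuous_intros)
  have "F (pi / 2) = - F 0"
    by (simp add: F_def lin inner_commute)
  then obtain t where t: "F t = 0"
    using IVT'[of F 0 0 "pi / 2", OF _ _ _ cont] IVT2'[of F "pi / 2" 0 0, OF _ _ _ cont]
    by (cases "F 0 \<le> 0") auto
  have wv: "x = (w t \<bullet> x) *\<^sub>R w t + (w' t \<bullet> x) *\<^sub>R w' t" for x
  proof -
    have "x $ 1 = (c * x $ 1 + s * x $ 2) * c - (c * x $ 2 - s * x $ 1) * s"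
      "x $ 2 = (c * x $ 1 + s * x $ 2) * s + (c * x $ 2 - s * x $ 1) * c" if "s\<^sup>2 + c\<^sup>2 = 1" for c s
      using that by algebra+
    from this[OF sin_cos_squared_add[of t]] show ?thesis
      by (simp add: vec_eq_iff forall_2 w_def w'_def inner_vec_def sum_2 algebra_simps)
  qed
  have ww: "w t \<bullet> w t = 1" "w' t \<bullet> w' t = 1" "w t \<bullet> w' t = 0"
    by (simp_all add: w_def w'_def inner_vec_def sum_2 flip: power2_eq_square)
  have "E *v x \<noteq> 0" if "x \<bullet> x = 1" for x
    using inj that matrix_vector_mult_0_right[of E] by (metis inj_eq inner_zero_left zero_neq_one)
  then have nz: "E *v w t \<noteq> 0" "E *v w' t \<noteq> 0"
    using ww by blast+
  show thesis
    by (rule that[of "w t" "w' t" "(1 / norm (E *v w t)) *\<^sub>R (E *v w t)" "(1 / norm (E *v w' t)) *\<^sub>R (E *v w' t)"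
            "norm (E *v w t)" "norm (E *v w' t)"])
       (use wv ww nz t in \<open>auto simp: F_def dot_square_norm power2_eq_square\<close>)
qed

definition outer :: "real^'n \<Rightarrow> real^'m \<Rightarrow> real^'m^'n" where
  "outer u v = (\<chi> i j. u $ i * v $ j)"

lemma outer_mult_vec [simp]: "outer u v *v x = (v \<bullet> x) *\<^sub>R u"
  by (simp add: outer_def vec_eq_iff matrix_vector_mult_def inner_vec_def sum_distrib_left mult_ac)

lemma transpose_outer [simp]: "transpose (outer u v) = outer v u"
  by (simp add: outer_def transpose_def vec_eq_iff mult.commute)

lemma matrix_mult_outer: "A ** outer u v = outer (A *v u) v"
  by (simp add: outer_def vec_eq_iff matrix_matrix_mult_def matrix_vector_mult_def sum_distrib_left mult_ac)

text \<open>
  \<open>E V\<close> is the positive semidefinite square root of \<open>E E'\<close>; all its correction terms lie in the column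
  space of \<open>X\<close>, so that the factor below is \<open>\<surd>c I\<close> up to \<open>X\<close>-translations.
\<close>
lemma factor_modulo_columns:
  fixes X :: "real^'k^'n" and J :: "real^2^'k"
  assumes inj: "inj ((*v) (X ** J))"
  obtains V :: "real^'n^2" and A :: "real^2^'k" and K :: "real \<Rightarrow> real^'n^'k"
  where "V ** transpose V = mat 1" "transpose V = X ** A"
    and "\<And>c. 0 \<le> c \<Longrightarrow> c \<le> 1 \<Longrightarrow> (sqrt c *\<^sub>R mat 1 + X ** K c) ** transpose (sqrt c *\<^sub>R mat 1 + X ** K c)
      = (1 - c) *\<^sub>R ((X ** J) ** transpose (X ** J)) + c *\<^sub>R mat 1"
    and "isCont K 0" "K 0 = J ** V"
proof -
  define E where "E = X ** J"
  have injE: "inj ((*v) E)" using inj by (simp add: E_def)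
  obtain w1 w2 :: "real^2" and u1 u2 :: "real^'n" and l1 l2 :: real
    where w: "\<And>x. x = (w1 \<bullet> x) *\<^sub>R w1 + (w2 \<bullet> x) *\<^sub>R w2"
    and ww: "w1 \<bullet> w1 = 1" "w2 \<bullet> w2 = 1" "w1 \<bullet> w2 = 0"
    and uu: "u1 \<bullet> u1 = 1" "u2 \<bullet> u2 = 1" "u1 \<bullet> u2 = 0"
    and l: "0 < l1" "0 < l2" and E: "E *v w1 = l1 *\<^sub>R u1" "E *v w2 = l2 *\<^sub>R u2"
    using singular_frame[OF injE] by blast
  have uu': "u2 \<bullet> u1 = 0" using uu by (simp add: inner_commute)
  \<comment> \<open>These are coefficient vectors of the left singular vectors: \<open>X\<close>
    maps them to \<open>u1\<close> and \<open>u2\<close>.\<close>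
  define z1 z2 where "z1 = (1 / l1) *\<^sub>R (J *v w1)" and "z2 = (1 / l2) *\<^sub>R (J *v w2)"
  have Xz: "X *v z1 = u1" "X *v z2 = u2"
    using E l by (simp_all add: E_def z1_def z2_def matrix_vector_mult_scaleR matrix_vector_mul_assoc)
  define V where "V = outer w1 u1 + outer w2 u2"
  define A where "A = outer z1 w1 + outer z2 w2"
  \<comment> \<open>Chosen so that \<open>sqrt c + s l c\<close> squares to
    \<open>(1 - c) * l^2 + c\<close>, the eigenvalue of the target matrix along the singular vector
    for \<open>l\<close>. At \<open>c = 0\<close> it equals \<open>l\<close>, which cancels the
    divisor in \<open>z1\<close> and \<open>z2\<close>.\<close>
  define s where "s l c = sqrt ((1 - c) * l\<^sup>2 + c) - sqrt c" for l c :: real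
  define K where "K c = s l1 c *\<^sub>R outer z1 u1 + s l2 c *\<^sub>R outer z2 u2" for c
  interpret Mk: bounded_bilinear "(**) :: real^'k^'n \<Rightarrow> real^'n^'k \<Rightarrow> real^'n^'n"
    by (rule bounded_bilinear_matrix_mult)
  interpret Mk2: bounded_bilinear "(**) :: real^'k^'n \<Rightarrow> real^2^'k \<Rightarrow> real^2^'n"
    by (rule bounded_bilinear_matrix_mult)
  have tr: "transpose (P + Q) = transpose P + transpose Q" "transpose (a *\<^sub>R P) = a *\<^sub>R transpose P"
    for P Q :: "real^'i^'j" and a
    by (simp_all add: transpose_def vec_eq_iff)
  have mv: "(a *\<^sub>R P) *v x = a *\<^sub>R (P *v x)" for P :: "real^'i^'j" and a x
    by (simp add: scaleR_matrix_vector_assoc)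
  note vec_simps = matrix_vector_mult_add_rdistrib matrix_vector_right_distrib mv matrix_vector_mult_scaleR
    inner_add_right inner_scaleR_right
  have VT: "transpose V = outer u1 w1 + outer u2 w2"
    by (simp add: V_def tr)
  have "V ** transpose V = mat 1"
    unfolding matrix_eq VT
    by (simp add: V_def matrix_vector_mul_assoc[symmetric] vec_simps uu uu' w[symmetric])
  moreover have "transpose V = X ** A"
    by (simp add: VT A_def Mk2.add_right matrix_mult_outer Xz)
  moreover have "(sqrt c *\<^sub>R mat 1 + X ** K c) ** transpose (sqrt c *\<^sub>R mat 1 + X ** K c)
      = (1 - c) *\<^sub>R (E ** transpose E) + c *\<^sub>R mat 1" if c: "0 \<le> c" "c \<le> 1" for c
  proof -
    have XK: "X ** K c = s l1 c *\<^sub>R outer u1 u1 + s l2 c *\<^sub>R outer u2 u2"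
      by (simp add: K_def Mk.add_right Mk.scaleR_right matrix_mult_outer Xz)
    have ET: "transpose E *v x = (l1 * (u1 \<bullet> x)) *\<^sub>R w1 + (l2 * (u2 \<bullet> x)) *\<^sub>R w2" for x
    proof -
      have "w \<bullet> (transpose E *v x) = (E *v w) \<bullet> x" for w
        by (metis dot_lmul_matrix inner_commute transpose_matrix_vector transpose_transpose)
      then show ?thesis
        using w[of "transpose E *v x"] by (simp add: E)
    qed
    have EET: "(E ** transpose E) *v x = (l1 * l1 * (u1 \<bullet> x)) *\<^sub>R u1 + (l2 * l2 * (u2 \<bullet> x)) *\<^sub>R u2" for x
      unfolding matrix_vector_mul_assoc[symmetric] ET by (simp add: vec_simps E mult_ac)
    have sq: "(sqrt c + s l c) * (sqrt c + s l c) = (1 - c) * l\<^sup>2 + c" for l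
      using c by (simp add: s_def)
    have key: "s l c * (s l c + 2 * sqrt c) = (1 - c) * (l * l)" for l
      using sq[of l] c by (simp add: algebra_simps power2_eq_square)
    show ?thesis
      unfolding matrix_eq XK
    proof
      fix x
      define a b where "a = u1 \<bullet> x" and "b = u2 \<bullet> x"
      let ?B = "sqrt c *\<^sub>R mat 1 + (s l1 c *\<^sub>R outer u1 u1 + s l2 c *\<^sub>R outer u2 u2)"
      have Bv: "?B *v y = sqrt c *\<^sub>R y + (s l1 c * (u1 \<bullet> y)) *\<^sub>R u1 + (s l2 c * (u2 \<bullet> y)) *\<^sub>R u2" for y
        by (simp add: vec_simps)
      have "(?B ** transpose ?B) *v x = ?B *v (?B *v x)"
        by (simp add: tr transpose_mat matrix_vector_mul_assoc)
      also have "\<dots> = (sqrt c * sqrt c) *\<^sub>R x + (s l1 c * (s l1 c + 2 * sqrt c) * a) *\<^sub>R u1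
          + (s l2 c * (s l2 c + 2 * sqrt c) * b) *\<^sub>R u2"
        unfolding Bv
        by (simp add: inner_add_right uu uu' a_def[symmetric] b_def[symmetric])
           (simp add: vec_eq_iff algebra_simps)
      also have "\<dots> = ((1 - c) *\<^sub>R (E ** transpose E) + c *\<^sub>R mat 1) *v x"
        unfolding key using c
        by (simp add: matrix_vector_mult_add_rdistrib mv EET a_def b_def) (simp add: vec_eq_iff algebra_simps)
      finally show "(?B ** transpose ?B) *v x = ((1 - c) *\<^sub>R (E ** transpose E) + c *\<^sub>R mat 1) *v x" .
    qed
  qed
  moreover have "isCont K 0"
    unfolding K_def s_def by (intro continuous_intros)
  moreover have "K 0 = J ** V"
  proof -
    have "J ** V = outer (J *v w1) u1 + outer (J *v w2) u2"
      unfolding V_def by (simp add: bounded_bilinear.add_right[OF bounded_bilinear_matrix_mult] matrix_mult_outer)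
    also have "\<dots> = K 0"
      using l by (simp add: K_def s_def z1_def z2_def outer_def vec_eq_iff)
    finally show ?thesis ..
  qed
  ultimately show thesis
    unfolding E_def by (rule that)
qed

text \<open>The quadratic form of \<open>B B'\<close> is at least \<open>c\<close> times the squared
  norm, so \<open>B'\<close> has trivial kernel.\<close>

lemma invertible_factor:
  fixes B :: "real^'n^'n" and E :: "real^'m^'n"
  assumes B: "B ** transpose B = a *\<^sub>R (E ** transpose E) + c *\<^sub>R mat 1" and "0 \<le> a" "0 < c"
  shows "invertible B"
proof -
  have "x = 0" if x: "transpose B *v x = 0" for x
  proof -
    have "0 = x \<bullet> ((B ** transpose B) *v x)"
      by (simp only: matrix_vector_mul_assoc[symmetric] x) simp
    also have "\<dots> = a * ((transpose E *v x) \<bullet> (transpose E *v x)) + c * (x \<bullet> x)"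
      unfolding B
      by (simp add: matrix_vector_mult_add_rdistrib scaleR_matrix_vector_assoc[symmetric] inner_add_right
          matrix_vector_mul_assoc[symmetric] dot_lmul_matrix[symmetric])
    finally have "c * (x \<bullet> x) \<le> 0"
      using \<open>0 \<le> a\<close> by (metis add_increasing inner_ge_zero mult_nonneg_nonneg order_refl)
    then show "x = 0"
      using \<open>0 < c\<close> inner_ge_zero[of x] by (metis inner_eq_zero_iff mult_le_0_iff not_less order_antisym)
  qed
  then have "invertible (transpose B)"
    by (simp add: invertible_left_inverse matrix_left_invertible_ker)
  then show ?thesis
    by (simp add: invertible_det_nz)
qed

text \<open>With \<open>W\<close> the inverse of \<open>B\<close>, one has
  \<open>S = B (I + \<Delta>) B'\<close> for \<open>\<Delta> = W (S - B B') W'\<close>, and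
  \<open>\<delta>\<close> is chosen so that \<open>\<Delta>\<close> has norm at most
  \<open>e\<close>. The symmetric root \<open>I + Y\<close> from \<open>sqrt_near_identity\<close>
  gives the new factor; it is invertible because \<open>Y\<close> has norm below 1.\<close>

lemma perturbed_factor:
  fixes B :: "real^'n^'n"
  assumes B: "invertible B" and e: "0 < e" "e < 1"
  obtains \<delta> where "0 < \<delta>"
    and "\<And>S. transpose S = S \<Longrightarrow> norm (S - B ** transpose B) \<le> \<delta> \<Longrightarrow>
      \<exists>Y. norm Y \<le> e \<and> invertible (B ** (mat 1 + Y)) \<and> S = (B ** (mat 1 + Y)) ** transpose (B ** (mat 1 + Y))"
proof -
  interpret M: bounded_bilinear "(**) :: real^'n^'n \<Rightarrow> real^'n^'n \<Rightarrow> real^'n^'n"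
    by (rule bounded_bilinear_matrix_mult)
  have tr: "transpose (P + Q) = transpose P + transpose Q" "transpose (P - Q) = transpose P - transpose Q"
    for P Q :: "real^'n^'n"
    by (simp_all add: transpose_def vec_eq_iff)
  obtain W where W: "B ** W = mat 1" "W ** B = mat 1"
    using B by (auto simp: invertible_def)
  define \<delta> where "\<delta> = e / (norm W * norm W + 1)"
  have "0 < norm W * norm W + 1"
    by (simp add: add_nonneg_pos)
  then have \<delta>: "0 < \<delta>" "(norm W * norm W) * \<delta> \<le> e"
    using e by (auto simp: \<delta>_def field_simps)
  have "\<exists>Y. norm Y \<le> e \<and> invertible (B ** (mat 1 + Y)) \<and> S = (B ** (mat 1 + Y)) ** transpose (B ** (mat 1 + Y))"
    if S: "transpose S = S" "norm (S - B ** transpose B) \<le> \<delta>" for S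
  proof -
    define \<Delta> where "\<Delta> = W ** (S - B ** transpose B) ** transpose W"
    have "transpose \<Delta> = \<Delta>"
      by (simp add: \<Delta>_def matrix_transpose_mul tr S matrix_mul_assoc)
    moreover have "norm \<Delta> \<le> e"
    proof -
      have "norm \<Delta> \<le> norm (W ** (S - B ** transpose B)) * norm W"
        unfolding \<Delta>_def using norm_matrix_mult[of "W ** (S - B ** transpose B)" "transpose W"] by (simp add: norm_transpose)
      also have "\<dots> \<le> (norm W * norm (S - B ** transpose B)) * norm W"
        by (intro mult_right_mono norm_matrix_mult) simp
      also have "\<dots> \<le> (norm W * \<delta>) * norm W"
        by (intro mult_right_mono mult_left_mono S) auto
      finally show ?thesis using \<delta>(2) by (simp add: mult_ac)
    qed
    ultimately obtain Y where Y: "transpose Y = Y" "norm Y \<le> e" "(mat 1 + Y) ** (mat 1 + Y) = mat 1 + \<Delta>"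
      using sqrt_near_identity[of \<Delta> e] e by auto
    have "x = 0" if "(mat 1 + Y) *v x = 0" for x
    proof -
      have "x = - (Y *v x)"
        using that by (simp add: matrix_vector_mult_add_rdistrib eq_neg_iff_add_eq_0)
      then have "norm x \<le> norm Y * norm x"
        by (metis norm_matrix_vector_mult norm_minus_cancel)
      also have "\<dots> \<le> e * norm x"
        by (intro mult_right_mono Y) simp
      finally have "(1 - e) * norm x \<le> 0"
        by (simp add: algebra_simps)
      then show ?thesis using e by (simp add: mult_le_0_iff)
    qed
    then have "invertible (mat 1 + Y)"
      by (simp add: invertible_left_inverse matrix_left_invertible_ker)
    then have "invertible (B ** (mat 1 + Y))"
      by (rule invertible_mult[OF B])
    moreover have "(B ** (mat 1 + Y)) ** transpose (B ** (mat 1 + Y)) = S"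
    proof -
      have BW: "P ** B ** W = P" "transpose W ** transpose B = mat 1" for P
        by (simp_all add: W matrix_mul_assoc[symmetric] matrix_transpose_mul[symmetric] transpose_mat)
      have "(B ** (mat 1 + Y)) ** transpose (B ** (mat 1 + Y)) = B ** ((mat 1 + Y) ** (mat 1 + Y)) ** transpose B"
        by (simp only: matrix_transpose_mul tr Y(1) transpose_mat matrix_mul_assoc)
      also have "\<dots> = B ** transpose B + (B ** W) ** (S - B ** transpose B) ** (transpose W ** transpose B)"
        unfolding Y(3) \<Delta>_def by (simp add: M.add_left M.add_right matrix_mul_assoc)
      also have "\<dots> = S"
        by (simp add: W BW)
      finally show ?thesis .
    qed
    ultimately show ?thesis using Y by metis
  qed
  with \<delta>(1) show thesis by (rule that)
qed

section \<open>The test statistic\<close>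

lemma matrix_inv_eqI: "A ** B = mat 1 \<Longrightarrow> matrix_inv A = B" for A B :: "real^'n^'n"
proof -
  assume AB: "A ** B = mat 1"
  then have BA: "B ** A = mat 1" by (simp add: matrix_left_right_inverse)
  have "A ** matrix_inv A = mat 1 \<and> matrix_inv A ** A = mat 1"
    unfolding matrix_inv_def by (rule someI[of _ B]) (simp add: AB BA)
  then show ?thesis
    by (metis BA matrix_mul_assoc matrix_mul_lid matrix_mul_rid)
qed

lemma matrix_inv_works:
  assumes "det (A :: real^'n^'n) \<noteq> 0"
  shows "A ** matrix_inv A = mat 1" "matrix_inv A ** A = mat 1"
proof -
  obtain B where B: "A ** B = mat 1" "B ** A = mat 1"
    using assms by (auto simp: invertible_det_nz[symmetric] invertible_def)
  then show "A ** matrix_inv A = mat 1" "matrix_inv A ** A = mat 1"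
    using matrix_inv_eqI[OF B(1)] by simp_all
qed

text \<open>Writing the inverse through determinants reduces its continuity to that of
  \<open>det\<close>.\<close>

lemma matrix_inv_mult_vec_cramer:
  assumes "det (A :: real^'n^'n) \<noteq> 0"
  shows "matrix_inv A *v v = (\<chi> k. det (\<chi> i j. if j = k then v $ i else A $ i $ j) / det A)"
  using cramer[OF assms, of "matrix_inv A *v v" v]
  by (simp add: matrix_vector_mul_assoc matrix_inv_works[OF assms])

lemma quad_form_matrix_inv_scaleR:
  assumes "det (A :: real^'n^'n) \<noteq> 0" "a \<noteq> 0"
  shows "quad_form (matrix_inv (a *\<^sub>R A)) v = quad_form (matrix_inv A) v / a"
proof -
  have "matrix_inv (a *\<^sub>R A) = (1 / a) *\<^sub>R matrix_inv A"
    using assms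
    by (intro matrix_inv_eqI)
       (simp add: bounded_bilinear.scaleR_left[OF bounded_bilinear_matrix_mult]
         bounded_bilinear.scaleR_right[OF bounded_bilinear_matrix_mult] matrix_inv_works)
  then show ?thesis
    by (simp add: quad_form_def scaleR_matrix_vector_assoc[symmetric])
qed

lemma quad_form_scaleR: "quad_form A (t *\<^sub>R v) = t\<^sup>2 * quad_form A v"
  by (simp add: quad_form_def matrix_vector_mult_scaleR power2_eq_square)

lemma tendsto_det [tendsto_intros]:
  fixes A :: "'a \<Rightarrow> real^'n^'n"
  assumes "(A \<longlongrightarrow> A0) F"
  shows "((\<lambda>x. det (A x)) \<longlongrightarrow> det A0) F"
  unfolding det_def by (intro tendsto_intros assms)

lemma tendsto_quad_form_matrix_inv:
  fixes A :: "'a \<Rightarrow> real^'q^'q"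
  assumes A: "(A \<longlongrightarrow> A0) F" and v: "(v \<longlongrightarrow> v0) F" and det: "det A0 \<noteq> 0"
  shows "((\<lambda>x. quad_form (matrix_inv (A x)) (v x)) \<longlongrightarrow> quad_form (matrix_inv A0) v0) F"
proof -
  let ?q = "\<lambda>(A :: real^'q^'q) v. v \<bullet> (\<chi> k. det (\<chi> i j. if j = k then v $ i else A $ i $ j) / det A)"
  have q: "quad_form (matrix_inv A) v = ?q A v" if "det A \<noteq> 0" for A :: "real^'q^'q" and v
    unfolding quad_form_def matrix_inv_mult_vec_cramer[OF that] ..
  have "((\<lambda>x. if j = k then v x $ i else A x $ i $ j) \<longlongrightarrow> (if j = k then v0 $ i else A0 $ i $ j)) F" for i j k
    using A v by (cases "j = k") (auto intro!: tendsto_intros)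
  then have "((\<lambda>x. ?q (A x) (v x)) \<longlongrightarrow> ?q A0 v0) F"
    by (intro tendsto_intros A v det)
  moreover have "eventually (\<lambda>x. det (A x) \<noteq> 0) F"
    by (rule tendsto_imp_eventually_ne[OF tendsto_det[OF A] det])
  then have "eventually (\<lambda>x. ?q (A x) (v x) = quad_form (matrix_inv (A x)) (v x)) F"
    by eventually_elim (simp add: q)
  ultimately show ?thesis
    unfolding q[OF det] by (rule Lim_transform_eventually)
qed

lemma continuous_on_quad_form_matrix_inv:
  assumes "continuous_on S A" "continuous_on S v" "\<And>x. x \<in> S \<Longrightarrow> det (A x) \<noteq> 0"
  shows "continuous_on S (\<lambda>x. quad_form (matrix_inv (A x)) (v x))"
  using assms unfolding continuous_on_def by (blast intro: tendsto_quad_form_matrix_inv)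

section \<open>Equivariance, measurability and divergence of the statistic\<close>

context
  fixes X :: "real^'k^'n" and \<beta> :: "real^'n \<Rightarrow> real^'k" and \<Omega> :: "real^'n \<Rightarrow> real^'q^'q" and N :: "(real^'n) set"
  assumes est: "estimator_conditions X \<beta> \<Omega> N"
begin

lemma notin_Nstar_iff: "y \<notin> Nstar \<Omega> N \<longleftrightarrow> y \<notin> N \<and> det (\<Omega> y) \<noteq> 0"
  by (auto simp: Nstar_def)

lemma open_compl_Nstar: "open (- Nstar \<Omega> N)"
proof -
  have "continuous_on (- N) \<Omega>" "open (- N)"
    using est by (auto simp: estimator_conditions_def)
  then have "continuous_on (- N) (\<lambda>y. det (\<Omega> y))"
    unfolding continuous_on_def by (blast intro: tendsto_det)
  then have "open (- N \<inter> (\<lambda>y. det (\<Omega> y)) -` (- {0}))"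
    using \<open>open (- N)\<close> by (intro continuous_open_preimage) auto
  also have "- N \<inter> (\<lambda>y. det (\<Omega> y)) -` (- {0}) = - Nstar \<Omega> N"
    using notin_Nstar_iff by auto
  finally show ?thesis .
qed

lemma continuous_on_compl_Nstar: "continuous_on (- Nstar \<Omega> N) \<Omega>" "continuous_on (- Nstar \<Omega> N) \<beta>"
  using est by (auto simp: estimator_conditions_def Nstar_def intro: continuous_on_subset)

lemma AE_notin_Nstar: "AE y in lborel. y \<notin> Nstar \<Omega> N"
proof -
  have "AE y in lborel. y \<notin> N"
    using est by (intro AE_not_in) (simp add: estimator_conditions_def)
  moreover have "AE y in lborel. y \<notin> N \<longrightarrow> invertible (\<Omega> y)"
    using est by (simp add: estimator_conditions_def)
  ultimately show ?thesis
    by eventually_elim (simp add: notin_Nstar_iff invertible_det_nz)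
qed

lemma estimator_shift:
  assumes y: "y \<notin> Nstar \<Omega> N" and \<delta>: "\<delta> \<noteq> 0"
  shows "\<delta> *\<^sub>R y + X *v \<eta> \<notin> Nstar \<Omega> N"
    and "\<beta> (\<delta> *\<^sub>R y + X *v \<eta>) = \<delta> *\<^sub>R \<beta> y + \<eta>"
    and "\<Omega> (\<delta> *\<^sub>R y + X *v \<eta>) = \<delta>\<^sup>2 *\<^sub>R \<Omega> y"
proof -
  have "y \<notin> N" "det (\<Omega> y) \<noteq> 0" using y by (auto simp: notin_Nstar_iff)
  with est \<delta> have N: "\<delta> *\<^sub>R y + X *v \<eta> \<notin> N"
    and \<beta>: "\<beta> (\<delta> *\<^sub>R y + X *v \<eta>) = \<delta> *\<^sub>R \<beta> y + \<eta>"
    and \<Omega>: "\<Omega> (\<delta> *\<^sub>R y + X *v \<eta>) = \<delta>\<^sup>2 *\<^sub>R \<Omega> y"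
    unfolding estimator_conditions_def by blast+
  then show "\<beta> (\<delta> *\<^sub>R y + X *v \<eta>) = \<delta> *\<^sub>R \<beta> y + \<eta>" "\<Omega> (\<delta> *\<^sub>R y + X *v \<eta>) = \<delta>\<^sup>2 *\<^sub>R \<Omega> y"
    by blast+
  have "det (\<delta>\<^sup>2 *\<^sub>R \<Omega> y) \<noteq> 0"
  proof -
    have "invertible (\<delta>\<^sup>2 *\<^sub>R \<Omega> y)"
      unfolding invertible_def using \<delta> matrix_inv_works[OF \<open>det (\<Omega> y) \<noteq> 0\<close>]
      by (intro exI[of _ "(1 / \<delta>\<^sup>2) *\<^sub>R matrix_inv (\<Omega> y)"])
         (simp add: bounded_bilinear.scaleR_left[OF bounded_bilinear_matrix_mult]
           bounded_bilinear.scaleR_right[OF bounded_bilinear_matrix_mult])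
    then show ?thesis by (simp add: invertible_det_nz)
  qed
  with N show "\<delta> *\<^sub>R y + X *v \<eta> \<notin> Nstar \<Omega> N"
    by (simp add: notin_Nstar_iff \<Omega>)
qed

lemma shift_in_Nstar_iff: "y + X *v \<eta> \<in> Nstar \<Omega> N \<longleftrightarrow> y \<in> Nstar \<Omega> N"
  using estimator_shift(1)[of y 1 \<eta>] estimator_shift(1)[of "y + X *v \<eta>" 1 "- \<eta>"]
  by (auto simp: matrix_vector_right_distrib[symmetric] add.assoc)

text \<open>The shift enters only through the estimator of the coefficients, while the scale leaves
  the inverse of \<open>\<Omega>\<close> as the divisor \<open>\<delta>^2\<close>. For small scales
  this divisor drives the statistic to infinity unless the vector in the form shrinks as
  well.\<close>

lemma T_stat_shift:
  assumes y: "y \<notin> Nstar \<Omega> N" and \<delta>: "\<delta> \<noteq> 0"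
  shows "T_stat R r \<beta> \<Omega> N (\<delta> *\<^sub>R y + X *v \<eta>)
    = quad_form (matrix_inv (\<Omega> y)) (\<delta> *\<^sub>R (R *v \<beta> y) + (R *v \<eta> - r)) / \<delta>\<^sup>2"
proof -
  have "det (\<Omega> y) \<noteq> 0" using y by (simp add: notin_Nstar_iff)
  then show ?thesis
    using estimator_shift[OF y \<delta>, of \<eta>] \<delta>
    by (simp add: T_stat_def quad_form_matrix_inv_scaleR matrix_vector_right_distrib
        matrix_vector_mult_scaleR add_diff_eq)
qed

lemma T_stat_measurable [measurable]: "T_stat R r \<beta> \<Omega> N \<in> borel_measurable borel"
proof -
  have "(\<lambda>y. indicator (- Nstar \<Omega> N) y *\<^sub>R quad_form (matrix_inv (\<Omega> y)) (R *v \<beta> y - r)) \<in> borel_measurable borel"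
    using open_compl_Nstar
    by (intro borel_measurable_continuous_on_indicator continuous_on_quad_form_matrix_inv continuous_on_compl_Nstar
        continuous_intros bounded_linear.continuous_on[OF matrix_vector_mul_bounded_linear])
       (auto simp: notin_Nstar_iff)
  also have "(\<lambda>y. indicator (- Nstar \<Omega> N) y *\<^sub>R quad_form (matrix_inv (\<Omega> y)) (R *v \<beta> y - r)) = T_stat R r \<beta> \<Omega> N"
    by (auto simp: T_stat_def fun_eq_iff)
  finally show ?thesis .
qed

text \<open>
  Up to translations along the columns of \<open>X\<close> the argument of \<open>T\<close> is \<open>\<sigma> \<surd>c (I + Y) z\<close>, so \<open>\<Omega>\<close> is of order
  \<open>c\<close>, while \<open>R \<beta> - r\<close> does not vanish in the limit.
\<close>
lemma T_stat_diverges: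
  fixes K :: "real \<Rightarrow> real^'n^'k" and Y :: "nat \<Rightarrow> real^'n^'n"
  assumes z: "z \<notin> Nstar \<Omega> N" and pos: "0 < quad_form (matrix_inv (\<Omega> z)) (R *v (K 0 *v z))"
    and K: "isCont K 0" and c: "c \<longlonglongrightarrow> 0" "\<And>m. 0 < c m" and Y: "Y \<longlonglongrightarrow> 0" and \<sigma>: "0 < \<sigma>"
    and \<beta>0: "R *v \<beta>0 = r"
  shows "eventually (\<lambda>m. b \<le> T_stat R r \<beta> \<Omega> N (X *v \<beta>0
    + (\<sigma> *\<^sub>R ((sqrt (c m) *\<^sub>R mat 1 + X ** K (c m)) ** (mat 1 + Y m))) *v z)) sequentially"
proof -
  interpret mv: bounded_bilinear "(*v) :: real^'i^'j \<Rightarrow> real^'i \<Rightarrow> real^'j"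
  proof (rule bounded_bilinear.intro)
    show "\<exists>K. \<forall>A x. norm ((A :: real^'i^'j) *v x) \<le> norm A * norm x * K"
      by (rule exI[of _ 1]) (simp add: norm_matrix_vector_mult)
  qed (simp_all add: matrix_vector_mult_add_rdistrib matrix_vector_right_distrib matrix_vector_mult_scaleR
      scaleR_matrix_vector_assoc)
  define y where "y m = z + Y m *v z" for m
  have y: "y \<longlonglongrightarrow> z"
    unfolding y_def using tendsto_add[OF tendsto_const mv.tendsto[OF Y tendsto_const], of z z] by simp
  have ev: "eventually (\<lambda>m. y m \<in> - Nstar \<Omega> N) sequentially"
    using topological_tendstoD[OF y open_compl_Nstar] z by simp
  have cont: "isCont \<Omega> z" "isCont \<beta> z"
    using continuous_on_compl_Nstar z open_compl_Nstar by (auto simp: continuous_on_eq_continuous_at)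
  have \<Omega>: "(\<lambda>m. \<Omega> (y m)) \<longlonglongrightarrow> \<Omega> z" and \<beta>: "(\<lambda>m. \<beta> (y m)) \<longlonglongrightarrow> \<beta> z"
    using cont y by (auto intro: isCont_tendsto_compose)
  have Kc: "(\<lambda>m. K (c m)) \<longlonglongrightarrow> K 0"
    by (rule isCont_tendsto_compose[OF K c(1)])
  have sc: "(\<lambda>m. sqrt (c m)) \<longlonglongrightarrow> 0"
    using tendsto_real_sqrt[OF c(1)] by simp
  \<comment> \<open>This is the statistic multiplied by \<open>c m\<close>: the factor
    \<open>\<sigma>^2\<close> cancels, and \<open>\<Omega>\<close> contributes the divisor
    \<open>c m\<close>. As \<open>c m\<close> tends to 0 the term with \<open>\<beta>\<close>
    disappears from the limit.\<close>
  define q where "q m = quad_form (matrix_inv (\<Omega> (y m))) (sqrt (c m) *\<^sub>R (R *v \<beta> (y m)) + R *v (K (c m) *v y m))" for m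
  have "q \<longlonglongrightarrow> quad_form (matrix_inv (\<Omega> z)) (0 *\<^sub>R (R *v \<beta> z) + R *v (K 0 *v z))"
    unfolding q_def using z
    by (intro tendsto_quad_form_matrix_inv tendsto_intros \<Omega> sc
        bounded_linear.tendsto[OF matrix_vector_mul_bounded_linear] \<beta> mv.tendsto Kc y)
       (simp add: notin_Nstar_iff)
  then have q: "q \<longlonglongrightarrow> quad_form (matrix_inv (\<Omega> z)) (R *v (K 0 *v z))"
    by simp
  have "filterlim (\<lambda>m. inverse (c m)) at_top sequentially"
    using c by (intro filterlim_inverse_at_top) auto
  then have "filterlim (\<lambda>m. q m * inverse (c m)) at_top sequentially"
    by (rule filterlim_tendsto_pos_mult_at_top[OF q pos])
  then have "eventually (\<lambda>m. b \<le> q m * inverse (c m)) sequentially"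
    by (simp add: filterlim_at_top)
  with ev show ?thesis
  proof eventually_elim
    case (elim m)
    have "X *v \<beta>0 + (\<sigma> *\<^sub>R ((sqrt (c m) *\<^sub>R mat 1 + X ** K (c m)) ** (mat 1 + Y m))) *v z
        = X *v \<beta>0 + \<sigma> *\<^sub>R ((sqrt (c m) *\<^sub>R mat 1 + X ** K (c m)) *v y m)"
      by (simp add: scaleR_matrix_vector_assoc[symmetric] matrix_vector_mul_assoc[symmetric] y_def
          matrix_vector_mult_add_rdistrib)
    also have "\<dots> = (\<sigma> * sqrt (c m)) *\<^sub>R y m + X *v (\<beta>0 + \<sigma> *\<^sub>R (K (c m) *v y m))"
      by (simp add: scaleR_matrix_vector_assoc[symmetric] matrix_vector_mul_assoc[symmetric]
          matrix_vector_mult_add_rdistrib matrix_vector_right_distrib matrix_vector_mult_scaleR scaleR_right_distrib)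
    finally have arg: "X *v \<beta>0 + (\<sigma> *\<^sub>R ((sqrt (c m) *\<^sub>R mat 1 + X ** K (c m)) ** (mat 1 + Y m))) *v z
        = (\<sigma> * sqrt (c m)) *\<^sub>R y m + X *v (\<beta>0 + \<sigma> *\<^sub>R (K (c m) *v y m))" .
    have "T_stat R r \<beta> \<Omega> N ((\<sigma> * sqrt (c m)) *\<^sub>R y m + X *v (\<beta>0 + \<sigma> *\<^sub>R (K (c m) *v y m)))
        = quad_form (matrix_inv (\<Omega> (y m)))
            (\<sigma> *\<^sub>R (sqrt (c m) *\<^sub>R (R *v \<beta> (y m)) + R *v (K (c m) *v y m))) / (\<sigma> * sqrt (c m))\<^sup>2"
      using elim(1) \<sigma> c(2)[of m]
      by (subst T_stat_shift)
         (auto simp: matrix_vector_right_distrib matrix_vector_mult_scaleR \<beta>0 scaleR_right_distrib)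
    also have "\<dots> = q m * inverse (c m)"
      using \<sigma> c(2)[of m] unfolding quad_form_scaleR q_def by (simp add: power_mult_distrib divide_inverse mult_ac)
    finally show ?case
      using elim(2) by (simp add: arg)
  qed
qed

end



section \<open>The trend matrix\<close>

text \<open>The kernel of a nonzero matrix is a proper subspace. It serves to show that
  \<open>R J x\<close> is almost surely nonzero for a standard normal \<open>x\<close>.\<close>

lemma null_sets_kernel:
  fixes A :: "real^'n^'m"
  assumes "A \<noteq> 0"
  shows "{x. A *v x = 0} \<in> null_sets lborel"
proof -
  have sub: "subspace {x. A *v x = 0}"
    by (rule linear_subspace_kernel) simp
  have "{x. A *v x = 0} \<noteq> UNIV"
    using assms by (auto simp: matrix_eq)
  then have "dim {x. A *v x = 0} < DIM(real^'n)"
    using sub by (metis dim_eq_full dim_subset_UNIV le_neq_implies_less span_eq_iff)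
  then have "negligible {x. A *v x = 0}"
    by (rule negligible_lowdim)
  moreover have "{x. A *v x = 0} \<in> sets lborel"
    using closed_subspace[OF sub] by simp
  ultimately show ?thesis
    by (simp add: negligible_iff_null_sets null_sets_completion_iff)
qed

lemma ols_mult:
  assumes "inj ((*v) (X :: real^'k^'n))"
  shows "ols X (X *v \<eta>) = \<eta>"
proof -
  have "x = 0" if "(transpose X ** X) *v x = 0" for x
  proof -
    have "(X *v x) \<bullet> (X *v x) = x \<bullet> ((transpose X ** X) *v x)"
      by (metis dot_lmul_matrix matrix_vector_mul_assoc transpose_matrix_vector inner_commute transpose_transpose)
    then have "X *v x = X *v 0" by (simp add: that)
    with assms show ?thesis by (simp only: inj_eq)
  qed
  then have "invertible (transpose X ** X)"
    by (simp add: invertible_left_inverse matrix_left_invertible_ker)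
  then show ?thesis
    unfolding ols_def matrix_vector_mul_assoc
    by (simp add: matrix_inv_works invertible_det_nz matrix_mul_assoc[symmetric])
qed

text \<open>The matrix \<open>J\<close> embeds the plane into the coordinates of the first two
  columns of \<open>X\<close>, which are those of the trend matrix.\<close>

lemma cyclical_trend_factor:
  fixes X :: "real^'k::{finite,linorder}^'n::{finite,linorder}"
  assumes "cyclical_trend X \<omega>" and inj: "inj ((*v) X)"
  obtains J :: "real^2^'k::{finite,linorder}" where "X ** J = trendE 0 \<omega>" "inj ((*v) (X ** J))"
    and "\<And>i. pos i = 1 \<Longrightarrow> J *v axis 1 1 = axis i 1" "\<And>i. pos i = 2 \<Longrightarrow> J *v axis 2 1 = axis i 1"
proof -
  have card: "2 \<le> CARD('k)" using assms by (simp add: cyclical_trend_def)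
  obtain i1 :: 'k where i1: "pos i1 = 1" using pos_surj[of 1] card by (metis le_refl one_le_numeral order_trans)
  obtain i2 :: 'k where i2: "pos i2 = 2" using pos_surj[of 2] card by (metis one_le_numeral)
  have X: "X *v axis i1 1 = column 1 (trendE 0 \<omega>)" "X *v axis i2 1 = column 2 (trendE 0 \<omega>)"
    using assms i1 i2 by (auto simp: cyclical_trend_def matrix_vector_mult_basis)
  define J :: "((real, 2) vec, 'k) vec" where
    "J = (\<chi> i j. if j = 1 then axis i1 1 $ i else axis i2 1 $ i)"
  have J: "J *v x = x $ 1 *\<^sub>R axis i1 1 + x $ 2 *\<^sub>R axis i2 1" for x
    by (simp add: J_def vec_eq_iff matrix_vector_mult_def sum_2 mult.commute)
  have XJ: "X ** J = trendE 0 \<omega>"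
    unfolding matrix_eq
  proof
    fix x :: "real^2"
    have "(X ** J) *v x = x $ 1 *\<^sub>R (X *v axis i1 1) + x $ 2 *\<^sub>R (X *v axis i2 1)"
      by (simp only: matrix_vector_mul_assoc[symmetric] J matrix_vector_right_distrib matrix_vector_mult_scaleR)
    also have "\<dots> = trendE 0 \<omega> *v x"
      unfolding X by (simp add: vec_eq_iff column_def matrix_vector_mult_def sum_2 mult.commute)
    finally show "(X ** J) *v x = trendE 0 \<omega> *v x" .
  qed
  have "i1 \<noteq> i2" using i1 i2 by auto
  have "x = y" if "J *v x = J *v y" for x y :: "real^2"
  proof -
    have "(J *v x) $ i1 = (J *v y) $ i1" "(J *v x) $ i2 = (J *v y) $ i2" using that by simp_all
    then show ?thesis
      using \<open>i1 \<noteq> i2\<close> by (simp add: J vec_eq_iff forall_2 axis_def)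
  qed
  then have "inj ((*v) (X ** J))"
    using inj unfolding inj_def by (metis matrix_vector_mul_assoc)
  moreover have "J *v axis 1 1 = axis i 1" if "pos i = 1" for i
    using that i1 pos_inj[of i i1] by (simp add: J axis_def)
  moreover have "J *v axis 2 1 = axis i 1" if "pos i = 2" for i
    using that i2 pos_inj[of i i2] by (simp add: J axis_def)
  ultimately show thesis by (rule that[OF XJ])
qed

text \<open>As \<open>X\<close> is injective, \<open>J x\<close> is the only coefficient vector of
  \<open>E x\<close>. An \<open>x\<close> with \<open>R J x\<close> nonzero therefore takes
  \<open>E x\<close> out of \<open>M0lin\<close> already for exponent 0.\<close>

lemma rho_eq_0:
  fixes X :: "real^'k^'n::{finite,linorder}" and R :: "real^'k^'q"
  assumes inj: "inj ((*v) X)" and XJ: "X ** J = trendE 0 \<omega>" and RJ: "R ** J \<noteq> 0"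
  shows "rho X R \<omega> = 0"
proof -
  obtain x where "(R ** J) *v x \<noteq> 0"
    using RJ by (auto simp: matrix_eq)
  then have x: "R *v (J *v x) \<noteq> 0"
    by (simp add: matrix_vector_mul_assoc)
  have "trendE 0 \<omega> *v x = X *v (J *v x)"
    by (simp add: XJ[symmetric] matrix_vector_mul_assoc)
  then have "trendE 0 \<omega> *v x \<notin> M0lin X R"
    using x inj by (auto simp: M0lin_def dest: injD)
  moreover have "trendE 0 \<omega> *v x \<in> span (columns (trendE 0 \<omega> :: ((real, 2) vec, 'n) vec))"
    by (rule matrix_vector_mult_in_columnspace)
  ultimately have "\<not> span (columns (trendE 0 \<omega> :: ((real, 2) vec, 'n) vec)) \<subseteq> M0lin X R"
    by blast
  then show ?thesis
    unfolding rho_def by (rule Least_eq_0)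
qed

section \<open>The bounds\<close>

theorem theorem5p13:
  fixes X :: "real^'k::{finite,linorder}^'n::{finite,linorder}"
    and R :: "(real, 'k) vec^'q"
    and r :: "real^'q"
    and \<omega> :: real
    and \<beta> :: "(real, 'n) vec \<Rightarrow> (real, 'k) vec"
    and \<Omega> :: "(real, 'n) vec \<Rightarrow> real^'q^'q"
    and N :: "(real, 'n) vec set"
    and F :: "(real \<Rightarrow> real) set"
    and Pr :: "'a measure" and G :: "'a \<Rightarrow> (real, 'n) vec"
    and C \<sigma>2 :: real and \<mu>0 :: "(real, 'n) vec"
  assumes "CARD('k) < CARD('n)"
    and "rank X = CARD('k)"
    and "rank R = CARD('q)"
    and "F \<subseteq> F_all" and "F_AR2_ext \<subseteq> F"
    and "0 < \<omega>" and "\<omega> < pi" and "cyclical_trend X \<omega>"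
    and "\<exists>i. pos i \<in> {1, 2} \<and> column i R \<noteq> 0"
    and "estimator_conditions X \<beta> \<Omega> N"
    and "\<And>v. v \<noteq> 0 \<Longrightarrow>
           {y. y \<notin> Nstar \<Omega> N \<and> quad_form (matrix_inv (\<Omega> y)) v = 0} \<in> null_sets lborel"
    and "prob_space Pr" and "G \<in> borel_measurable Pr" and "distr Pr borel G = gaussian 0 (mat 1)"
    and "\<mu>0 \<in> M0 X R r" and "0 < \<sigma>2"
  defines "K \<equiv> (\<integral>x. measure Pr {w \<in> space Pr. 0 \<le> xi_bar X R \<Omega> N \<omega> x (G w)}
                   \<partial>gaussian (0 :: real^2) (mat 1))"
  shows "measure (gaussian 0 (mat 1)) {y. y \<notin> N \<and> nonneg_definite (\<Omega> y)} \<le> K \<and>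
         K \<le> (SUP f\<in>F. measure (gaussian \<mu>0 (\<sigma>2 *\<^sub>R Sigma_mat f)) {y. C \<le> T_stat R r \<beta> \<Omega> N y})"
proof -
  have inj: "inj ((*v) X)"
    using \<open>rank X = CARD('k)\<close> by (simp add: full_rank_injective)
  note est = \<open>estimator_conditions X \<beta> \<Omega> N\<close>
  have \<Omega>_null: "{y. y \<notin> Nstar \<Omega> N \<and> quad_form (matrix_inv (\<Omega> y)) v = 0} \<in> null_sets lborel" if "v \<noteq> 0" for v
    using assms(11) that by blast
  obtain J :: "real^2^'k::{finite,linorder}" where XJ: "X ** J = trendE 0 \<omega>" and injXJ: "inj ((*v) (X ** J))"
    and J: "\<And>i. pos i = 1 \<Longrightarrow> J *v axis 1 1 = axis i 1" "\<And>i. pos i = 2 \<Longrightarrow> J *v axis 2 1 = axis i 1"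
    using cyclical_trend_factor[OF \<open>cyclical_trend X \<omega>\<close> inj] by metis
  \<comment> \<open>The two columns of \<open>R J\<close> are the first two columns of
    \<open>R\<close>, one of which is nonzero.\<close>
  have RJ: "R ** J \<noteq> 0"
  proof
    assume 0: "R ** J = 0"
    obtain i where i: "pos i \<in> {1, 2}" "column i R \<noteq> 0"
      using assms(9) by blast
    then obtain x where "J *v x = axis i 1"
      using J by blast
    then have "column i R = (R ** J) *v x"
      by (simp add: matrix_vector_mul_assoc[symmetric] matrix_vector_mult_basis)
    with i 0 show False by simp
  qed
  have rho: "rho X R \<omega> = 0"
    by (rule rho_eq_0[OF inj XJ RJ])

  \<comment> \<open>The limiting quadratic form and its invariance\<close>
  define xi where "xi = xi_bar X R \<Omega> N \<omega>"
  have xi: "xi x y = (if y \<in> Nstar \<Omega> N then 0 else quad_form (matrix_inv (\<Omega> y)) ((R ** J) *v x))" for x y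
  proof -
    have E: "trendE (rho X R \<omega>) \<omega> *v x = X *v (J *v x)"
      by (simp add: rho XJ matrix_vector_mul_assoc)
    show ?thesis
      unfolding xi_def xi_bar_def E ols_mult[OF inj] by (simp only: matrix_vector_mul_assoc)
  qed
  obtain V :: "(real, 'n) vec^2" and A :: "real^2^'k::{finite,linorder}" and Kc :: "real \<Rightarrow> ((real, 'n) vec, 'k) vec"
    where VV: "V ** transpose V = mat 1" and VA: "transpose V = X ** A"
    and fac: "\<And>c. 0 \<le> c \<Longrightarrow> c \<le> 1 \<Longrightarrow>
      (sqrt c *\<^sub>R mat 1 + X ** Kc c) ** transpose (sqrt c *\<^sub>R mat 1 + X ** Kc c)
        = (1 - c) *\<^sub>R ((X ** J) ** transpose (X ** J)) + c *\<^sub>R mat 1"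
    and Kc: "isCont Kc 0" "Kc 0 = J ** V"
    using factor_modulo_columns[OF injXJ] by metis
  \<comment> \<open>The range of \<open>V'\<close> lies in the column space of \<open>X\<close>, and
    \<open>\<Omega>\<close> is constant along that space; this is the invariance asked for by
    \<open>std_gauss_swap\<close>.\<close>
  have xi_shift: "xi x (y + transpose V *v w) = xi x y" for x y w
  proof -
    have *: "transpose V *v w = X *v (A *v w)"
      by (simp add: VA matrix_vector_mul_assoc)
    show ?thesis
      unfolding xi * shift_in_Nstar_iff[OF est]
      using estimator_shift(3)[OF est, of y 1 "A *v w"] by simp
  qed

  \<comment> \<open>Measurability of the quadratic form\<close>
  have xi_meas [measurable]: "(\<lambda>p. xi (fst p) (snd p)) \<in> borel_measurable borel"
  proof -
    have "(\<lambda>p. indicator (UNIV \<times> - Nstar \<Omega> N) p *\<^sub>R quad_form (matrix_inv (\<Omega> (snd p))) ((R ** J) *v fst p))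
        \<in> borel_measurable borel"
    proof (intro borel_measurable_continuous_on_indicator continuous_on_quad_form_matrix_inv)
      show "UNIV \<times> - Nstar \<Omega> N \<in> sets borel"
        using open_compl_Nstar[OF est] by (intro borel_open open_Times) auto
      show "continuous_on (UNIV \<times> - Nstar \<Omega> N) (\<lambda>p. \<Omega> (snd p))"
        by (rule continuous_on_compose2[OF continuous_on_compl_Nstar(1)[OF est]]) (auto intro!: continuous_intros)
      show "continuous_on (UNIV \<times> - Nstar \<Omega> N) (\<lambda>p. (R ** J) *v fst p)"
        by (intro bounded_linear.continuous_on[OF matrix_vector_mul_bounded_linear] continuous_intros)
    qed (auto simp: Nstar_def)
    also have "(\<lambda>p. indicator (UNIV \<times> - Nstar \<Omega> N) p *\<^sub>R quad_form (matrix_inv (\<Omega> (snd p))) ((R ** J) *v fst p))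
        = (\<lambda>p. xi (fst p) (snd p))"
      by (auto simp: xi fun_eq_iff)
    finally show ?thesis .
  qed
  have mv_meas [measurable]: "(\<lambda>z. M *v z) \<in> borel_measurable borel" for M :: "real^'i^'j"
    by (intro borel_measurable_continuous_onI linear_continuous_on) simp
  have xiV_meas [measurable]: "(\<lambda>z. xi (V *v z) z) \<in> borel_measurable borel"
  proof -
    have "(\<lambda>z. (V *v z, z)) \<in> borel_measurable borel"
      by (intro borel_measurable_continuous_onI continuous_intros linear_continuous_on) simp
    from measurable_compose[OF this xi_meas] show ?thesis by simp
  qed
  have [measurable]: "xi x \<in> borel_measurable borel" for x
  proof -
    have "(\<lambda>z. (x, z)) \<in> borel_measurable borel"
      by (intro borel_measurable_continuous_onI continuous_intros)
    from measurable_compose[OF this xi_meas] show ?thesis by simp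
  qed
  have Nstar_borel [measurable]: "Nstar \<Omega> N \<in> sets borel"
    using open_compl_Nstar[OF est] by (simp add: borel_closed closed_open)
  interpret G: prob_space "std_gauss :: (real, 'n) vec measure"
    by (rule prob_space_std_gauss)
  interpret G2: prob_space "std_gauss :: (real^2) measure"
    by (rule prob_space_std_gauss)
  interpret GG: pair_prob_space "std_gauss :: (real^2) measure" "std_gauss :: (real, 'n) vec measure" ..

  \<comment> \<open>The constant \<open>K\<close> as a probability for a single Gaussian
    vector\<close>
  have KV: "K = measure std_gauss {z. 0 \<le> xi (V *v z) z}"
  proof -
    let ?S = "{p. 0 \<le> xi (fst p) (snd p)}"
    have S: "?S \<in> sets (std_gauss \<Otimes>\<^sub>M std_gauss)"
      unfolding std_gauss_pair by simp
    have sec: "Pair x -` ?S = {y. 0 \<le> xi x y}" for x by auto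
    have inner: "measure Pr {w \<in> space Pr. 0 \<le> xi x (G w)} = measure std_gauss {y. 0 \<le> xi x y}" for x
    proof -
      have "measure (distr Pr borel G) {y. 0 \<le> xi x y} = measure Pr (G -` {y. 0 \<le> xi x y} \<inter> space Pr)"
        using \<open>G \<in> borel_measurable Pr\<close> by (intro measure_distr) auto
      also have "G -` {y. 0 \<le> xi x y} \<inter> space Pr = {w \<in> space Pr. 0 \<le> xi x (G w)}"
        by auto
      finally show ?thesis
        using \<open>distr Pr borel G = gaussian 0 (mat 1)\<close> by (simp add: gaussian_0_mat_1)
    qed
    have [measurable]: "(\<lambda>x. emeasure std_gauss {y. 0 \<le> xi x y}) \<in> borel_measurable std_gauss"
      using G.measurable_emeasure_Pair[OF S] unfolding sec .
    have [measurable]: "(\<lambda>x. measure std_gauss {y. 0 \<le> xi x y}) \<in> borel_measurable std_gauss"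
      unfolding measure_def by measurable
    have "ennreal K = (\<integral>\<^sup>+x. ennreal (measure std_gauss {y. 0 \<le> xi x y}) \<partial>std_gauss)"
      unfolding K_def xi_def[symmetric] inner gaussian_0_mat_1
      by (intro nn_integral_eq_integral[symmetric] G2.integrable_const_bound[of _ 1]) auto
    also have "\<dots> = emeasure std_gauss ?S"
      using G.emeasure_pair_measure_alt[OF S] unfolding sec std_gauss_pair
      by (simp add: G.emeasure_eq_measure)
    \<comment> \<open>Here the independent planar vector is traded for \<open>V z\<close>.\<close>
    also have "\<dots> = emeasure std_gauss {z. 0 \<le> xi (V *v z) z}"
      by (rule std_gauss_swap[OF VV, symmetric]) (simp_all only: xi_shift, measurable)
    also have "\<dots> = ennreal (measure std_gauss {z. 0 \<le> xi (V *v z) z})"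
      by (rule G.emeasure_eq_measure)
    finally show ?thesis
      unfolding K_def by (subst (asm) ennreal_inj) (auto intro!: integral_nonneg)
  qed

  \<comment> \<open>The lower bound for \<open>K\<close>\<close>
  have first: "measure (gaussian 0 (mat 1)) {y. y \<notin> N \<and> nonneg_definite (\<Omega> y)} \<le> K"
    unfolding KV gaussian_0_mat_1
  proof (rule G.finite_measure_mono)
    show "{z. 0 \<le> xi (V *v z) z} \<in> sets std_gauss" by simp
    show "{y. y \<notin> N \<and> nonneg_definite (\<Omega> y)} \<subseteq> {z. 0 \<le> xi (V *v z) z}"
    proof clarify
      fix z assume z: "z \<notin> N" "nonneg_definite (\<Omega> z)"
      show "0 \<le> xi (V *v z) z"
      \<comment> \<open>On the exceptional set the default value 0 of \<open>xi\<close> satisfies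
        the inequality. Elsewhere the form of the inverse at \<open>v\<close> is the form of
        \<open>\<Omega>\<close> at the vector obtained by applying the inverse to
        \<open>v\<close>.\<close>
      proof (cases "z \<in> Nstar \<Omega> N")
        case False
        then have "det (\<Omega> z) \<noteq> 0" by (auto simp: Nstar_def)
        define v where "v = (R ** J) *v (V *v z)"
        have "quad_form (matrix_inv (\<Omega> z)) v = quad_form (\<Omega> z) (matrix_inv (\<Omega> z) *v v)"
          unfolding quad_form_def
          by (simp add: matrix_vector_mul_assoc matrix_inv_works[OF \<open>det (\<Omega> z) \<noteq> 0\<close>] inner_commute)
        also have "\<dots> \<ge> 0" using z by (simp add: nonneg_definite_def)
        finally show ?thesis using False by (simp add: xi v_def)
      qed (simp add: xi)
    qed
  qed

  \<comment> \<open>Almost sure nonvanishing of the quadratic form\<close>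
  have AE_xi: "AE z in std_gauss. z \<notin> Nstar \<Omega> N \<and> xi (V *v z) z \<noteq> 0"
  proof -
    let ?Q = "\<lambda>x y. y \<notin> Nstar \<Omega> N \<and> xi x y = 0"
    have shiftN: "y + transpose V *v w \<in> Nstar \<Omega> N \<longleftrightarrow> y \<in> Nstar \<Omega> N" for y w
      using shift_in_Nstar_iff[OF est, of y "A *v w"] by (simp add: VA matrix_vector_mul_assoc)
    have snd_meas: "(snd -` Nstar \<Omega> N :: ((real^2) \<times> (real, 'n) vec) set) \<in> sets borel"
      using open_compl_Nstar[OF est] by (intro borel_closed closed_vimage_snd) (simp add: closed_open)
    have Q: "{p. ?Q (fst p) (snd p)} \<in> sets borel"
    proof -
      have "{p. ?Q (fst p) (snd p)} = {p. xi (fst p) (snd p) = 0} - snd -` Nstar \<Omega> N" by auto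
      moreover have "{p. xi (fst p) (snd p) = 0} \<in> sets borel"
        using measurable_sets_borel[OF xi_meas, of "{0}"] by (simp add: vimage_def)
      ultimately show ?thesis using snd_meas by (simp only: sets.Diff)
    qed
    have QV: "{z. ?Q (V *v z) z} \<in> sets borel" by simp
    have QS: "{p. ?Q (fst p) (snd p)} \<in> sets (std_gauss \<Otimes>\<^sub>M std_gauss)"
      unfolding std_gauss_pair using Q by simp
    \<comment> \<open>The exchange makes the planar vector independent of \<open>y\<close>. For
      almost every fixed \<open>x\<close> the vector \<open>R J x\<close> is nonzero, and the
      hypothesis on null sets applies to it.\<close>
    have "emeasure std_gauss {z. ?Q (V *v z) z} = emeasure std_gauss {p. ?Q (fst p) (snd p)}"
      by (rule std_gauss_swap[OF VV Q QV]) (simp only: xi_shift shiftN)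
    also have "\<dots> = (\<integral>\<^sup>+x. emeasure std_gauss {y. ?Q x y} \<partial>std_gauss)"
      using G.emeasure_pair_measure_alt[OF QS] unfolding std_gauss_pair by (simp add: vimage_def)
    also have "\<dots> = (\<integral>\<^sup>+(x::real^2). 0 \<partial>std_gauss)"
    proof (rule nn_integral_cong_AE)
      have "AE x in (std_gauss :: (real^2) measure). (R ** J) *v x \<noteq> 0"
        unfolding AE_std_gauss_iff using AE_not_in[OF null_sets_kernel[OF RJ]] by simp
      then show "AE x in std_gauss. emeasure std_gauss {y. ?Q x y} = 0"
      proof eventually_elim
        case (elim x)
        have "{y. ?Q x y} = {y. y \<notin> Nstar \<Omega> N \<and> quad_form (matrix_inv (\<Omega> y)) ((R ** J) *v x) = 0}"
          by (auto simp: xi)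
        then have "{y. ?Q x y} \<in> null_sets lborel"
          using \<Omega>_null[OF elim] by simp
        then have "AE y in std_gauss. y \<notin> {y. ?Q x y}"
          unfolding AE_std_gauss_iff by (rule AE_not_in)
        moreover have "{y. ?Q x y} \<in> sets std_gauss" by simp
        ultimately show ?case
          by (subst (asm) AE_iff_measurable[of "{y. ?Q x y}"]) auto
      qed
    qed
    finally have "{z. ?Q (V *v z) z} \<in> null_sets std_gauss"
      using QV by (simp add: null_sets_def)
    then have "AE z in std_gauss. z \<notin> {z. ?Q (V *v z) z}"
      by (rule AE_not_in)
    moreover have "AE z in std_gauss. z \<notin> Nstar \<Omega> N"
      unfolding AE_std_gauss_iff by (rule AE_notin_Nstar[OF est])
    ultimately show ?thesis by eventually_elim simp
  qed

  \<comment> \<open>Densities whose covariance matrices approach the singular limit\<close>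
  obtain \<beta>0 where \<beta>0: "\<mu>0 = X *v \<beta>0" "R *v \<beta>0 = r"
    using \<open>\<mu>0 \<in> M0 X R r\<close> by (auto simp: M0_def)
  \<comment> \<open>The offset 2 keeps the weights strictly below 1, as
    \<open>perturbed_factor\<close> requires.\<close>
  define c where "c m = 1 / (real m + 2)" for m :: nat
  have c: "0 < c m" "c m < 1" for m by (auto simp: c_def field_simps)
  have c_lim: "c \<longlonglongrightarrow> 0"
    unfolding c_def by real_asymp
  define B where "B m Y = (sqrt (c m) *\<^sub>R mat 1 + X ** Kc (c m)) ** (mat 1 + Y)"
    for m and Y :: "((real, 'n) vec, 'n) vec"
  \<comment> \<open>The weight \<open>c m\<close> also bounds the perturbation \<open>Y\<close>. The
    accuracy \<open>\<delta>\<close> is obtained first from the factor for this weight, then the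
    spike is made sharp enough.\<close>
  have "\<exists>f Y. f \<in> F \<and> norm Y \<le> c m \<and> invertible (B m Y) \<and> Sigma_mat f = B m Y ** transpose (B m Y)" for m
  proof -
    let ?B = "sqrt (c m) *\<^sub>R mat 1 + X ** Kc (c m)"
    have BB: "?B ** transpose ?B = (1 - c m) *\<^sub>R ((X ** J) ** transpose (X ** J)) + c m *\<^sub>R mat 1"
      using c[of m] by (intro fac) auto
    have "invertible ?B"
      using c[of m] by (intro invertible_factor[OF BB]) auto
    then obtain \<delta> where \<delta>: "0 < \<delta>"
      and pert: "\<And>S. transpose S = S \<Longrightarrow> norm (S - ?B ** transpose ?B) \<le> \<delta> \<Longrightarrow>
        \<exists>Y. norm Y \<le> c m \<and> invertible (?B ** (mat 1 + Y)) \<and> S = (?B ** (mat 1 + Y)) ** transpose (?B ** (mat 1 + Y))"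
      using perturbed_factor[OF _ c(1)[of m] c(2)[of m]] by metis
    obtain f where "f \<in> F_AR2_ext" "transpose (Sigma_mat f) = (Sigma_mat f :: ((real, 'n) vec, 'n) vec)"
      "norm (Sigma_mat f - ((1 - c m) *\<^sub>R ((X ** J) ** transpose (X ** J)) + c m *\<^sub>R mat 1)) \<le> \<delta>"
      using F_AR2_ext_spike[OF \<open>0 < \<omega>\<close> \<open>\<omega> < pi\<close> _ _ \<delta> XJ, of "c m"] c[of m] by auto
    with pert[of "Sigma_mat f"] \<open>F_AR2_ext \<subseteq> F\<close> show ?thesis
      unfolding B_def BB by blast
  qed
  then obtain f Y where f: "\<And>m. f m \<in> F" and Y: "\<And>m. norm (Y m) \<le> c m"
    and Binv: "\<And>m. invertible (B m (Y m))"
    and Sig: "\<And>m. Sigma_mat (f m) = B m (Y m) ** transpose (B m (Y m))"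
    by metis
  have Y_lim: "Y \<longlonglongrightarrow> 0"
    by (rule Lim_null_comparison[OF _ c_lim]) (simp add: Y)

  \<comment> \<open>Rejection probabilities along the sequence\<close>
  define \<sigma> where "\<sigma> = sqrt \<sigma>2"
  have \<sigma>: "0 < \<sigma>" "\<sigma> * \<sigma> = \<sigma>2" using \<open>0 < \<sigma>2\<close> by (auto simp: \<sigma>_def)
  define P where "P f = measure (gaussian \<mu>0 (\<sigma>2 *\<^sub>R Sigma_mat f)) {y. C \<le> T_stat R r \<beta> \<Omega> N y}" for f
  have T_meas [measurable]: "T_stat R r \<beta> \<Omega> N \<in> borel_measurable borel"
    by (rule T_stat_measurable[OF est])
  have P_le_1: "P f \<le> 1" for f
  proof -
    have "prob_space (gaussian \<mu>0 (\<sigma>2 *\<^sub>R Sigma_mat f))"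
      unfolding gaussian_def prod_std_normal_density_vec std_gauss_def[symmetric]
      by (intro G.prob_space_distr) measurable
    then show ?thesis
      unfolding P_def by (rule prob_space.prob_le_1)
  qed
  have P_f: "ennreal (P (f m)) = (\<integral>\<^sup>+z. indicator {z. C \<le> T_stat R r \<beta> \<Omega> N (\<mu>0 + (\<sigma> *\<^sub>R B m (Y m)) *v z)} z \<partial>std_gauss)"
    for m
  proof -
    have "\<sigma>2 *\<^sub>R Sigma_mat (f m) = (\<sigma> *\<^sub>R B m (Y m)) ** transpose (\<sigma> *\<^sub>R B m (Y m))"
    proof -
      have "transpose (\<sigma> *\<^sub>R B m (Y m)) = \<sigma> *\<^sub>R transpose (B m (Y m))"
        by (simp add: transpose_def vec_eq_iff)
      then show ?thesis
        by (simp add: Sig bounded_bilinear.scaleR_left[OF bounded_bilinear_matrix_mult]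
            bounded_bilinear.scaleR_right[OF bounded_bilinear_matrix_mult] \<sigma>(2))
    qed
    moreover have "invertible (\<sigma> *\<^sub>R B m (Y m))"
      using \<sigma>(1) by (intro scalar_invertible[OF _ Binv, unfolded scalar_mult_eq_scaleR]) simp
    ultimately have "P (f m) = measure (distr std_gauss borel (\<lambda>z. \<mu>0 + (\<sigma> *\<^sub>R B m (Y m)) *v z)) {y. C \<le> T_stat R r \<beta> \<Omega> N y}"
      unfolding P_def by (simp add: gaussian_eq_distr)
    also have "\<dots> = measure std_gauss {z. C \<le> T_stat R r \<beta> \<Omega> N (\<mu>0 + (\<sigma> *\<^sub>R B m (Y m)) *v z)}"
      by (subst measure_distr) (auto simp: vimage_def)
    finally show ?thesis
      by (subst nn_integral_indicator) (auto simp: G.emeasure_eq_measure)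
  qed

  \<comment> \<open>The upper bound for \<open>K\<close> by Fatou's lemma\<close>
  have "K \<le> (SUP f\<in>F. P f)"
  proof -
    have bdd: "bdd_above (P ` F)" using P_le_1 by (intro bdd_aboveI2)
    have Sup: "P (f m) \<le> (SUP f\<in>F. P f)" for m
      by (rule cSUP_upper[OF f bdd])
    let ?T = "\<lambda>m z. indicator {z. C \<le> T_stat R r \<beta> \<Omega> N (\<mu>0 + (\<sigma> *\<^sub>R B m (Y m)) *v z)} z :: ennreal"
    have "ennreal K = (\<integral>\<^sup>+z. indicator {z. 0 \<le> xi (V *v z) z} z \<partial>std_gauss)"
      unfolding KV by (subst nn_integral_indicator) (auto simp: G.emeasure_eq_measure)
    also have "\<dots> \<le> (\<integral>\<^sup>+z. liminf (\<lambda>m. ?T m z) \<partial>std_gauss)"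
    proof (rule nn_integral_mono_AE)
      from AE_xi show "AE z in std_gauss. indicator {z. 0 \<le> xi (V *v z) z} z \<le> liminf (\<lambda>m. ?T m z)"
      proof eventually_elim
        case (elim z)
        show ?case
        proof (cases "0 \<le> xi (V *v z) z")
          case True
          \<comment> \<open>Only a strictly positive form forces divergence; the value 0 has been
            excluded almost surely.\<close>
          with elim have z: "z \<notin> Nstar \<Omega> N" and "0 < xi (V *v z) z" by auto
          then have "0 < quad_form (matrix_inv (\<Omega> z)) (R *v (Kc 0 *v z))"
            by (simp add: xi Kc(2) matrix_vector_mul_assoc matrix_mul_assoc)
          from T_stat_diverges[OF est z this Kc(1) c_lim c(1) Y_lim \<sigma>(1) \<beta>0(2), of C]
          have "eventually (\<lambda>m. 1 \<le> ?T m z) sequentially"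
            unfolding B_def \<beta>0(1) by eventually_elim simp
          then have "1 \<le> liminf (\<lambda>m. ?T m z)"
            by (rule Liminf_bounded)
          then show ?thesis using True by simp
        qed simp
      qed
    qed
    also have "\<dots> \<le> liminf (\<lambda>m. \<integral>\<^sup>+z. ?T m z \<partial>std_gauss)"
      by (rule nn_integral_liminf) measurable
    also have "\<dots> \<le> liminf (\<lambda>m. ennreal (SUP f\<in>F. P f))"
      unfolding P_f[symmetric] by (intro Liminf_mono always_eventually allI ennreal_leI Sup)
    also have "\<dots> = ennreal (SUP f\<in>F. P f)"
      by (rule Liminf_const) simp
    \<comment> \<open>Returning from \<open>ennreal\<close> to the reals needs a nonnegative
      supremum, which follows from any one member of the sequence.\<close>
    finally show ?thesis
      using order_trans[OF measure_nonneg Sup[unfolded P_def[abs_def], of 0]]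
      by (simp add: P_def[abs_def])
  qed
  with first show ?thesis
    unfolding P_def by blast
qed

end
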